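(* Assume $\Bbbk$ has characteristic zero. For every $t\in\mathbb N$ there is a short exact sequence of $\Bbbk\mathbf{FA}$-modules $$0\to\Lambda^t(\overline P)\to\Lambda^t(P^{\mathbf{FA}})\to\Lambda^{t-1}(\overline P)\to0,$$ induced by $0\to\overline P\to P^{\mathbf{FA}}\to\overline\Bbbk\to0$ (for $t=0$ this is $0\to\overline\Bbbk\to\Bbbk\to\Bbbk_{\mathbf 0}\to0$), and $\Lambda^t(P^{\mathbf{FA}})\to\Lambda^{t-1}(\overline P)$ is a projective cover of the simple functor $\Lambda^{t-1}(\overline P)$; in particular $\Lambda^t(P^{\mathbf{FA}})$ is an indecomposable projective.
   Context: Let $\Bbbk$ be a field. $\mathbf{FA}$ denotes the category of finite sets and all maps, and $\mathbf{FI}$, $\mathbf{FS}$, $\mathbf{FB}$ its wide subcategories of injections, surjections and bijections respectively; $\mathbf n=\{1,\dots,n\}$ for $n\in\mathbb N$ ($\mathbf 0=\emptyset$), and $\mathfrak S_n$ is the symmetric group. For a category $\mathcal C$, $\Bbbk\mathcal C(X,Y)$ is the $\Bbbk$-vector space with basis $\mathcal C(X,Y)$. A $\Bbbk\mathbf{FA}$-module is a functor from $\mathbf{FA}$ to $\Bbbk$-vector spaces (these form the abelian category $\mathcal F(\mathbf{FA})$); $\otimes$ denotes the pointwise tensor product over $\Bbbk$, and $\hom_{\Bbbk\mathbf{FA}}$ denotes natural transformations. $P^{\mathbf{FA}}_{\mathbf n}:=\Bbbk\mathbf{FA}(\mathbf n,-)$, so $P^{\mathbf{FA}}_{\mathbf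 n}(X)\cong\Bbbk[X]^{\otimes n}$ (where $\Bbbk[X]$ has basis $\{[x]:x\in X\}$), with the right $\mathfrak S_n$-action by precomposition, equivalently place permutation of tensor factors; write $P^{\mathbf{FA}}:=P^{\mathbf{FA}}_{\mathbf 1}$. Let $\overline{\Bbbk}$ be the functor with value $\Bbbk$ on non-empty sets (all maps acting by the identity) and $0$ on $\emptyset$, and $\Bbbk_{\mathbf 0}$ the functor with value $\Bbbk$ on $\emptyset$ and $0$ on non-empty sets. $\overline P$ is the kernel of the surjection $P^{\mathbf{FA}}\to\overline\Bbbk$, $[x]\mapsto 1$; thus $\overline P(X)=\{\sum_x a_x[x]:\sum_x a_x=0\}$. For $n\ge1$, $\overline P^{\otimes n}$ is the $n$-fold pointwise tensor power, a subfunctor of $P^{\mathbf{FA}}_{\mathbf n}$ stable under the place-permutation right action of $\mathfrak S_n$; by convention $\overline P^{\otimes 0}:=\overline\Bbbk$. For a partition $\lambda\vdash n$, $S_\lambda$ is the associated simple $\Bbbk\mathfrak S_n$-module, with $S_{(n)}$ trivial and $S_{(1^n)}=\mathsf{sgn}_n$ the sign representation. For a $\Bbbk\mathbf{FA}$-module $F$, $S_\lambda(F):=F^{\otimes n}\otimes_{\mathfrak S_n}S_\lambda$ (using the place-permutation right action on $F^{\otimes n}$), and $\Lambda^n(F):=S_{(1^n)}(F)$ is the $n$-th exterior power; conventions: $\Lambda^0(P^{\mathbf{FA}})=\Bbbk$ (the constant functor), $\Lambda^0(\overline P)=\overline\Bbbk$, $\Lambda^{-1}(\overline P)=\Bbbk_{\mathbf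 0}$. *)

theory Defs
  imports Complex_Main "HOL-Library.FuncSet" "HOL-Library.Function_Algebras"
          "HOL-Combinatorics.Permutations"
begin

text \<open>Objects of FA are modelled by finite sets X of natural numbers (a full,
essentially surjective subcategory of the category of all finite sets);
a morphism X -> Y is an extensional function f in X ->E Y.\<close>

definition FA_hom :: "nat set \<Rightarrow> nat set \<Rightarrow> (nat \<Rightarrow> nat) \<Rightarrow> bool" where
  "FA_hom X Y f \<longleftrightarrow> finite X \<and> finite Y \<and> f \<in> X \<rightarrow>\<^sub>E Y"

text \<open>A kFA-module is represented as a subquotient: for every finite X there are
subspaces N X of M X of an ambient k-vector space 'v (scalar multiplication s),
and F(X) = M X / N X.  The action act X Y f : M X -> M Y is linear and maps N X
into N Y.  Equalities in F(X) are equalities modulo N X.\<close>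

record 'v famod =
  Mo  :: "nat set \<Rightarrow> 'v set"
  Nu  :: "nat set \<Rightarrow> 'v set"
  act :: "nat set \<Rightarrow> nat set \<Rightarrow> (nat \<Rightarrow> nat) \<Rightarrow> 'v \<Rightarrow> 'v"

definition lin_on :: "('k \<Rightarrow> 'v::ab_group_add \<Rightarrow> 'v) \<Rightarrow> ('k \<Rightarrow> 'w \<Rightarrow> 'w) \<Rightarrow> 'v set
    \<Rightarrow> ('v \<Rightarrow> 'w::ab_group_add) \<Rightarrow> bool" where
  "lin_on s s' A h \<longleftrightarrow> (\<forall>u\<in>A. \<forall>v\<in>A. h (u + v) = h u + h v)
                     \<and> (\<forall>c. \<forall>v\<in>A. h (s c v) = s' c (h v))"

definition is_famod :: "('k::field \<Rightarrow> 'v \<Rightarrow> 'v) \<Rightarrow> ('v::ab_group_add) famod \<Rightarrow> bool" where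
  "is_famod s F \<longleftrightarrow> vector_space s
     \<and> (\<forall>X. finite X \<longrightarrow> module.subspace s (Mo F X) \<and> module.subspace s (Nu F X)
                         \<and> Nu F X \<subseteq> Mo F X)
     \<and> (\<forall>X Y f. FA_hom X Y f \<longrightarrow>
           (\<forall>v\<in>Mo F X. act F X Y f v \<in> Mo F Y)
         \<and> (\<forall>v\<in>Nu F X. act F X Y f v \<in> Nu F Y)
         \<and> lin_on s s (Mo F X) (act F X Y f))
     \<and> (\<forall>X. finite X \<longrightarrow> (\<forall>v\<in>Mo F X. act F X X (restrict id X) v - v \<in> Nu F X))
     \<and> (\<forall>X Y Z f g. FA_hom X Y f \<longrightarrow> FA_hom Y Z g \<longrightarrow>
           (\<forall>v\<in>Mo F X. act F X Z (compose X g f) v - act F Y Z g (act F X Y f v) \<in> Nu F Z))"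

text \<open>Natural transformations (represented by linear maps on representatives).\<close>

definition is_mor :: "('k::field \<Rightarrow> 'v \<Rightarrow> 'v) \<Rightarrow> ('k \<Rightarrow> 'w \<Rightarrow> 'w)
    \<Rightarrow> ('v::ab_group_add) famod \<Rightarrow> ('w::ab_group_add) famod \<Rightarrow> (nat set \<Rightarrow> 'v \<Rightarrow> 'w) \<Rightarrow> bool" where
  "is_mor s s' F G \<eta> \<longleftrightarrow>
     (\<forall>X. finite X \<longrightarrow> (\<forall>v\<in>Mo F X. \<eta> X v \<in> Mo G X) \<and> (\<forall>v\<in>Nu F X. \<eta> X v \<in> Nu G X)
                     \<and> lin_on s s' (Mo F X) (\<eta> X))
   \<and> (\<forall>X Y f. FA_hom X Y f \<longrightarrow>
        (\<forall>v\<in>Mo F X. \<eta> Y (act F X Y f v) - act G X Y f (\<eta> X v) \<in> Nu G Y))"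

definition is_epi :: "('v::ab_group_add) famod \<Rightarrow> ('w::ab_group_add) famod \<Rightarrow> (nat set \<Rightarrow> 'v \<Rightarrow> 'w) \<Rightarrow> bool" where
  "is_epi F G \<eta> \<longleftrightarrow> (\<forall>X. finite X \<longrightarrow> (\<forall>w\<in>Mo G X. \<exists>v\<in>Mo F X. \<eta> X v - w \<in> Nu G X))"

definition is_mono :: "('v::ab_group_add) famod \<Rightarrow> ('w::ab_group_add) famod \<Rightarrow> (nat set \<Rightarrow> 'v \<Rightarrow> 'w) \<Rightarrow> bool" where
  "is_mono F G \<eta> \<longleftrightarrow> (\<forall>X. finite X \<longrightarrow> (\<forall>v\<in>Mo F X. \<eta> X v \<in> Nu G X \<longrightarrow> v \<in> Nu F X))"

definition is_ses :: "('k::field \<Rightarrow> 'u \<Rightarrow> 'u) \<Rightarrow> ('k \<Rightarrow> 'v \<Rightarrow> 'v) \<Rightarrow> ('k \<Rightarrow> 'w \<Rightarrow> 'w)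
    \<Rightarrow> ('u::ab_group_add) famod \<Rightarrow> ('v::ab_group_add) famod \<Rightarrow> ('w::ab_group_add) famod
    \<Rightarrow> (nat set \<Rightarrow> 'u \<Rightarrow> 'v) \<Rightarrow> (nat set \<Rightarrow> 'v \<Rightarrow> 'w) \<Rightarrow> bool" where
  "is_ses s1 s2 s3 F G H a b \<longleftrightarrow>
     is_famod s1 F \<and> is_famod s2 G \<and> is_famod s3 H
   \<and> is_mor s1 s2 F G a \<and> is_mor s2 s3 G H b
   \<and> is_mono F G a \<and> is_epi G H b
   \<and> (\<forall>X. finite X \<longrightarrow> (\<forall>v\<in>Mo F X. b X (a X v) \<in> Nu H X))
   \<and> (\<forall>X. finite X \<longrightarrow> (\<forall>w\<in>Mo G X. b X w \<in> Nu H X \<longrightarrow> (\<exists>v\<in>Mo F X. a X v - w \<in> Nu G X)))"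

text \<open>Subfunctors of F (given by their preimages in M, containing N).\<close>

definition is_subfunctor :: "('k::field \<Rightarrow> 'v \<Rightarrow> 'v) \<Rightarrow> ('v::ab_group_add) famod
    \<Rightarrow> (nat set \<Rightarrow> 'v set) \<Rightarrow> bool" where
  "is_subfunctor s F U \<longleftrightarrow>
     (\<forall>X. finite X \<longrightarrow> module.subspace s (U X) \<and> Nu F X \<subseteq> U X \<and> U X \<subseteq> Mo F X)
   \<and> (\<forall>X Y f. FA_hom X Y f \<longrightarrow> (\<forall>v\<in>U X. act F X Y f v \<in> U Y))"

definition is_zero_mod :: "('v::ab_group_add) famod \<Rightarrow> bool" where
  "is_zero_mod F \<longleftrightarrow> (\<forall>X. finite X \<longrightarrow> Mo F X \<subseteq> Nu F X)"

definition is_simple :: "('k::field \<Rightarrow> 'v \<Rightarrow> 'v) \<Rightarrow> ('v::ab_group_add) famod \<Rightarrow> bool" where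
  "is_simple s F \<longleftrightarrow> is_famod s F \<and> \<not> is_zero_mod F
     \<and> (\<forall>U. is_subfunctor s F U \<longrightarrow>
           (\<forall>X. finite X \<longrightarrow> U X = Nu F X) \<or> (\<forall>X. finite X \<longrightarrow> U X = Mo F X))"

definition is_indecomposable :: "('k::field \<Rightarrow> 'v \<Rightarrow> 'v) \<Rightarrow> ('v::ab_group_add) famod \<Rightarrow> bool" where
  "is_indecomposable s F \<longleftrightarrow> is_famod s F \<and> \<not> is_zero_mod F
     \<and> (\<forall>U1 U2. is_subfunctor s F U1 \<longrightarrow> is_subfunctor s F U2 \<longrightarrow>
           (\<forall>X. finite X \<longrightarrow> U1 X \<inter> U2 X = Nu F X
                 \<and> (\<forall>v\<in>Mo F X. \<exists>a\<in>U1 X. \<exists>b\<in>U2 X. v = a + b)) \<longrightarrow>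
           (\<forall>X. finite X \<longrightarrow> U1 X = Nu F X) \<or> (\<forall>X. finite X \<longrightarrow> U2 X = Nu F X))"

text \<open>Projectivity, tested against all kFA-modules with values in an arbitrary
type 'w (the type is universally quantified at the level of theorems).\<close>

definition is_projective :: "'w::ab_group_add itself \<Rightarrow> ('k::field \<Rightarrow> 'v \<Rightarrow> 'v)
    \<Rightarrow> ('v::ab_group_add) famod \<Rightarrow> bool" where
  "is_projective _ s P \<longleftrightarrow> is_famod s P \<and>
     (\<forall>(sG :: 'k \<Rightarrow> 'w \<Rightarrow> 'w) (G :: 'w famod) (H :: 'w famod) g h.
        is_famod sG G \<longrightarrow> is_famod sG H \<longrightarrow> is_mor sG sG G H g \<longrightarrow> is_epi G H g \<longrightarrow>
        is_mor s sG P H h \<longrightarrow>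
        (\<exists>l. is_mor s sG P G l \<and>
             (\<forall>X. finite X \<longrightarrow> (\<forall>v\<in>Mo P X. g X (l X v) - h X v \<in> Nu H X))))"

definition is_projective_cover :: "'w::ab_group_add itself \<Rightarrow> ('k::field \<Rightarrow> 'v \<Rightarrow> 'v)
    \<Rightarrow> ('k \<Rightarrow> 'u \<Rightarrow> 'u) \<Rightarrow> ('v::ab_group_add) famod \<Rightarrow> ('u::ab_group_add) famod
    \<Rightarrow> (nat set \<Rightarrow> 'v \<Rightarrow> 'u) \<Rightarrow> bool" where
  "is_projective_cover W s sS P S p \<longleftrightarrow>
     is_projective W s P \<and> is_famod sS S \<and> is_mor s sS P S p \<and> is_epi P S p
   \<and> (\<forall>U. is_subfunctor s P U \<longrightarrow>
        (\<forall>X. finite X \<longrightarrow> (\<forall>v\<in>Mo P X. \<exists>u\<in>U X. \<exists>k\<in>Mo P X. p X k \<in> Nu S X \<and> v = u + k)) \<longrightarrow>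
        (\<forall>X. finite X \<longrightarrow> U X = Mo P X))"

text \<open>Elements of k[X]^{\<otimes>t} are functions on lists of length t with entries in X
(the list xs corresponds to the basis tensor [x1] \<otimes> ... \<otimes> [xt]).\<close>

definition fsc :: "'k::field \<Rightarrow> (nat list \<Rightarrow> 'k) \<Rightarrow> (nat list \<Rightarrow> 'k)" where
  "fsc c \<phi> = (\<lambda>xs. c * \<phi> xs)"

definition lists_on :: "nat set \<Rightarrow> nat \<Rightarrow> nat list set" where
  "lists_on X t = {xs. length xs = t \<and> set xs \<subseteq> X}"

definition Ptens :: "nat \<Rightarrow> nat set \<Rightarrow> (nat list \<Rightarrow> 'k::field) set" where
  "Ptens t X = {\<phi>. \<forall>xs. \<phi> xs \<noteq> 0 \<longrightarrow> xs \<in> lists_on X t}"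

text \<open>Functoriality: [x1]\<otimes>...\<otimes>[xt] \<mapsto> [f x1]\<otimes>...\<otimes>[f xt].\<close>

definition push :: "nat set \<Rightarrow> (nat \<Rightarrow> nat) \<Rightarrow> (nat list \<Rightarrow> 'k::field) \<Rightarrow> (nat list \<Rightarrow> 'k)" where
  "push X f \<phi> = (\<lambda>ys. \<Sum>xs\<in>lists_on X (length ys). if map f xs = ys then \<phi> xs else 0)"

definition ev :: "nat \<Rightarrow> (nat list \<Rightarrow> 'k::field)" where
  "ev y = (\<lambda>zs. if zs = [y] then 1 else 0)"

definition tensorl :: "(nat list \<Rightarrow> 'k::field) list \<Rightarrow> (nat list \<Rightarrow> 'k)" where
  "tensorl us = (\<lambda>ys. if length ys = length us
                      then (\<Prod>i<length us. (us ! i) [ys ! i]) else 0)"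

definition Pbar :: "nat set \<Rightarrow> (nat list \<Rightarrow> 'k::field) set" where
  "Pbar X = {\<phi> \<in> Ptens 1 X. (\<Sum>x\<in>X. \<phi> [x]) = 0}"

text \<open>Tensor power of P-bar, a subfunctor of P^FA_t; by convention
P-bar^{\<otimes>0} = k-bar (k on non-empty sets, 0 on the empty set).\<close>

definition Pbar_tens :: "nat \<Rightarrow> nat set \<Rightarrow> (nat list \<Rightarrow> 'k::field) set" where
  "Pbar_tens t X = (if t = 0 then (if X = {} then {0} else Ptens 0 X)
     else module.span fsc {tensorl us | us. length us = t \<and> set us \<subseteq> Pbar X})"

text \<open>Place permutation of tensor factors and the coinvariant relations
defining F^{\<otimes>t} \<otimes>_{S_t} sgn = F^{\<otimes>t} / span { v - sgn(\<sigma>) v\<sigma> }.\<close>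

definition permact :: "(nat \<Rightarrow> nat) \<Rightarrow> (nat list \<Rightarrow> 'k::field) \<Rightarrow> (nat list \<Rightarrow> 'k)" where
  "permact \<sigma> \<phi> = (\<lambda>ys. \<phi> (map (\<lambda>i. ys ! \<sigma> i) [0..<length ys]))"

definition sgn_rel :: "nat \<Rightarrow> (nat list \<Rightarrow> 'k::field) set \<Rightarrow> (nat list \<Rightarrow> 'k) set" where
  "sgn_rel t V = module.span fsc
     {v - fsc (of_int (sign \<sigma>)) (permact \<sigma> v) | v \<sigma>. v \<in> V \<and> \<sigma> permutes {..<t}}"

definition LamP :: "nat \<Rightarrow> (nat list \<Rightarrow> 'k::field) famod" where
  "LamP t = \<lparr> Mo = Ptens t, Nu = (\<lambda>X. sgn_rel t (Ptens t X)), act = (\<lambda>X Y f. push X f) \<rparr>"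

definition LamPbar :: "nat \<Rightarrow> (nat list \<Rightarrow> 'k::field) famod" where
  "LamPbar t = \<lparr> Mo = Pbar_tens t, Nu = (\<lambda>X. sgn_rel t (Pbar_tens t X)),
                 act = (\<lambda>X Y f. push X f) \<rparr>"

definition kzero :: "(nat list \<Rightarrow> 'k::field) famod" where
  "kzero = \<lparr> Mo = (\<lambda>X. if X = {} then Ptens 0 X else {0}), Nu = (\<lambda>X. {0}),
             act = (\<lambda>X Y f \<phi>. if Y = {} then \<phi> else 0) \<rparr>"

definition LamPbar_pred :: "nat \<Rightarrow> (nat list \<Rightarrow> 'k::field) famod" where
  "LamPbar_pred t = (if t = 0 then kzero else LamPbar (t - 1))"

text \<open>The maps induced by 0 -> P-bar -> P^FA -> k-bar -> 0:
\<Lambda>^t(P-bar) -> \<Lambda>^t(P^FA) induced by the inclusion, and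
\<Lambda>^t(P^FA) -> \<Lambda>^{t-1}(P-bar) the contraction with the augmentation,
[x1]\<and>...\<and>[xt] \<mapsto> \<Sum>i (-1)^(i-1) [x1]\<and>..(omit i)..\<and>[xt]
                 = ([x2]-[x1]) \<and> ... \<and> ([xt]-[x1]);
for t = 0 these are k-bar -> k -> k_0.\<close>

definition iota_map :: "nat set \<Rightarrow> (nat list \<Rightarrow> 'k::field) \<Rightarrow> (nat list \<Rightarrow> 'k)" where
  "iota_map X \<phi> = \<phi>"

definition pi_map :: "nat \<Rightarrow> nat set \<Rightarrow> (nat list \<Rightarrow> 'k::field) \<Rightarrow> (nat list \<Rightarrow> 'k)" where
  "pi_map t X \<phi> = (if t = 0 then (if X = {} then \<phi> else 0)
     else (\<Sum>xs\<in>lists_on X t. fsc (\<phi> xs) (tensorl (map (\<lambda>y. ev y - ev (hd xs)) (tl xs)))))"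

end

theory Submission
  imports Defs
begin

text \<open>In characteristic zero a vector lies in the span of the sign relations iff all alternating
  functions, paired with it, give zero. Since \<open>x\<^sub>1 \<and> \<dots> \<and> x\<^sub>t
  = (x\<^sub>1 - z) \<and> \<dots> \<and> (x\<^sub>t - z) + z \<and> (x\<^sub>2 - x\<^sub>1) \<and> \<dots> \<and> (x\<^sub>t - x\<^sub>1)\<close>,
  any point \<open>z\<close> yields a contracting homotopy, hence exactness on non-empty sets.
  The functor \<open>\<Lambda>\<^sup>t(P)\<close> is generated by \<open>[1] \<and> \<dots> \<and> [t]\<close>, which spans its value on a set with
  \<open>t\<close> elements; so a subfunctor is everything or vanishes there, which makes it indecomposable
  and the kernel of the contraction superfluous. A non-zero element of
  \<open>\<Lambda>\<^sup>n(P-bar)\<close> has a non-zero image on a set with \<open>n + 1\<close> elements, where the functor is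
  one-dimensional and again generates, hence simplicity.\<close>

section \<open>Lists and permutations\<close>

text \<open>No quotient space is formed; membership in a span of relations becomes a system of
  linear equations. The test functions live on lists of points even for vectors in powers of P-bar,
  because P-bar has no natural basis: choosing one means choosing a base point, which maps of sets
  do not respect. The test refers to the subspace \<open>V\<close> only through membership, so the
  relations of a permutation-stable subspace are precisely the ambient relations that lie in it;
  this is the injectivity of the inclusion of exterior powers. Characteristic zero enters through
  the division by \<open>fact n\<close> in the antisymmetrizer and through the step from a = -a to a
  = 0. The homotopy depends on its point \<open>z\<close>. It is therefore used on one set at a time
  and yields no splitting of functors. On the empty set there is no \<open>z\<close>; there the
  conventions in degree 0 make the sequence exact.\<close>

lemma vector_space_fsc: "vector_space (fsc :: 'k::field \<Rightarrow> _)"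
  by unfold_locales (auto simp: fsc_def fun_eq_iff algebra_simps)

interpretation fsc: vector_space "fsc :: 'k::field \<Rightarrow> _"
  by (rule vector_space_fsc)

lemma sum_fun_apply: "(\<Sum>i\<in>I. f i) x = (\<Sum>i\<in>I. f i x)"
  for f :: "'i \<Rightarrow> 'a \<Rightarrow> 'b::comm_monoid_add"
  by (induction I rule: infinite_finite_induct) auto

lemma fsc_apply: "fsc c \<phi> xs = c * \<phi> xs"
  by (simp add: fsc_def)

lemma finite_lists_on [simp]: "finite X \<Longrightarrow> finite (lists_on X n)"
  using finite_lists_length_eq[of X n] by (simp add: lists_on_def conj_commute)

lemma lists_on_0 [simp]: "lists_on X 0 = {[]}"
  by (auto simp: lists_on_def)

lemma lists_on_Suc: "lists_on X (Suc n) = (\<lambda>(x, xs). x # xs) ` (X \<times> lists_on X n)"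
  by (auto simp: lists_on_def length_Suc_conv image_iff)

lemma sum_lists_on_Suc:
  "(\<Sum>xs\<in>lists_on X (Suc n). h xs) = (\<Sum>x\<in>X. \<Sum>xs\<in>lists_on X n. h (x # xs))"
proof -
  have "inj_on (\<lambda>(x, xs). x # xs) (X \<times> lists_on X n)"
    by (auto simp: inj_on_def)
  then show ?thesis
    by (simp add: lists_on_Suc sum.reindex sum.cartesian_product case_prod_unfold comp_def)
qed

lemma sum_lists_on_1: "(\<Sum>xs\<in>lists_on X (Suc 0). h xs) = (\<Sum>x\<in>X. h [x])"
  unfolding sum_lists_on_Suc lists_on_0 by simp

lemma permute_list_in_lists_on:
  "\<sigma> permutes {..<n} \<Longrightarrow> xs \<in> lists_on X n \<Longrightarrow> permute_list \<sigma> xs \<in> lists_on X n"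
  by (auto simp: lists_on_def)

lemma permute_list_inv:
  assumes "\<sigma> permutes {..<length xs}"
  shows "permute_list \<sigma> (permute_list (inv \<sigma>) xs) = xs"
    and "permute_list (inv \<sigma>) (permute_list \<sigma> xs) = xs"
proof -
  note inv = permutes_inv[OF assms]
  show "permute_list \<sigma> (permute_list (inv \<sigma>) xs) = xs"
    using permute_list_compose[OF assms, of "inv \<sigma>"] permutes_inv_o[OF assms] by simp
  show "permute_list (inv \<sigma>) (permute_list \<sigma> xs) = xs"
    using permute_list_compose[OF inv, of \<sigma>] permutes_inv_o[OF assms] by simp
qed

lemma sum_lists_on_permute:
  assumes "\<sigma> permutes {..<n}"
  shows "(\<Sum>xs\<in>lists_on X n. h (permute_list \<sigma> xs)) = (\<Sum>xs\<in>lists_on X n. h xs)"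
proof (rule sum.reindex_bij_witness[where i = "permute_list (inv \<sigma>)" and j = "permute_list \<sigma>"])
  note inv = permutes_inv[OF assms]
  fix xs assume "xs \<in> lists_on X n"
  then have len: "length xs = n" by (simp add: lists_on_def)
  show "permute_list (inv \<sigma>) (permute_list \<sigma> xs) = xs"
    "permute_list \<sigma> (permute_list (inv \<sigma>) xs) = xs"
    using permute_list_inv assms len by auto
  show "permute_list \<sigma> xs \<in> lists_on X n" "permute_list (inv \<sigma>) xs \<in> lists_on X n"
    using \<open>xs \<in> _\<close> assms inv by (auto intro: permute_list_in_lists_on)
qed auto

lemma permute_list_transpose_eq:
  assumes "i < length xs" "j < length xs" "xs ! i = xs ! j"
  shows "permute_list (transpose i j) xs = xs"
  using assms by (intro nth_equalityI) (auto simp: permute_list_def transpose_def)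

lemma permute_list_transpose_Suc:
  assumes "i < length xs" "j < length xs"
  shows "permute_list (transpose (Suc i) (Suc j)) (x # xs) = x # permute_list (transpose i j) xs"
  using assms
  by (intro nth_equalityI) (auto simp: permute_list_def transpose_def nth_Cons' simp del: upt_Suc)

lemma permute_list_transpose_0:
  "permute_list (transpose 0 (Suc (length as))) (x # as @ y # bs) = y # as @ x # bs"
  by (intro nth_equalityI)
    (auto simp: permute_list_def transpose_def nth_Cons' nth_append simp del: upt_Suc)

lemma transpose_permutes_lessThan: "i < n \<Longrightarrow> j < n \<Longrightarrow> transpose i j permutes {..<n}"
  by (rule permutes_swap_id) auto

section \<open>Alternating functions and the sign relations\<close>

text \<open>Only transpositions are asked for, so that closure properties are checked on two entries
  at a time. No length is fixed, because prefixing a point changes the degree.\<close>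

definition alternating :: "(nat list \<Rightarrow> 'k::field) \<Rightarrow> bool" where
  "alternating \<psi> \<longleftrightarrow> (\<forall>xs i j. i < length xs \<longrightarrow> j < length xs \<longrightarrow> i \<noteq> j \<longrightarrow>
     \<psi> (permute_list (transpose i j) xs) = - \<psi> xs)"

lemma alternatingD:
  "alternating \<psi> \<Longrightarrow> i < length xs \<Longrightarrow> j < length xs \<Longrightarrow> i \<noteq> j \<Longrightarrow>
   \<psi> (permute_list (transpose i j) xs) = - \<psi> xs"
  by (simp add: alternating_def)

text \<open>Every permutation is a product of transpositions and the sign is multiplicative. The
  inner claim ranges over all lists of length \<open>n\<close> because the induction hypothesis is
  applied to a list that is already transposed.\<close>

lemma alternating_permute:
  assumes "alternating \<psi>" "\<sigma> permutes {..<length xs}"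
  shows "\<psi> (permute_list \<sigma> xs) = of_int (sign \<sigma>) * \<psi> xs"
proof -
  have "\<forall>xs. length xs = n \<longrightarrow> \<psi> (permute_list \<sigma> xs) = of_int (sign \<sigma>) * \<psi> xs"
    if "\<sigma> permutes {..<n}" for n
    using that finite_lessThan
  proof (induction rule: permutes_induct)
    case id
    then show ?case by simp
  next
    case (swap a b p)
    show ?case
    proof (intro allI impI)
      fix xs :: "nat list" assume len: "length xs = n"
      have "\<psi> (permute_list (transpose a b \<circ> p) xs)
          = \<psi> (permute_list p (permute_list (transpose a b) xs))"
        using swap len by (simp add: permute_list_compose)
      also have "\<dots> = of_int (sign p) * \<psi> (permute_list (transpose a b) xs)"
        using swap len by simp
      also have "\<dots> = of_int (sign (transpose a b \<circ> p)) * \<psi> xs"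
        using swap len assms(1) permutation_permutes
        by (subst sign_compose)
          (auto simp: alternatingD sign_swap_id permutation_swap_id intro: exI[of _ "{..<n}"])
      finally show "\<psi> (permute_list (transpose a b \<circ> p) xs)
          = of_int (sign (transpose a b \<circ> p)) * \<psi> xs" .
    qed
  qed
  then show ?thesis using assms(2) by blast
qed

lemma alternating_eq_0:
  fixes \<psi> :: "nat list \<Rightarrow> 'k::field_char_0"
  assumes "alternating \<psi>" "\<not> distinct xs"
  shows "\<psi> xs = 0"
proof -
  obtain i j where ij: "i < length xs" "j < length xs" "i \<noteq> j" "xs ! i = xs ! j"
    using assms(2) by (auto simp: distinct_conv_nth)
  have "\<psi> xs = - \<psi> xs"
    using alternatingD[OF assms(1) ij(1-3)] permute_list_transpose_eq[OF ij(1,2,4)] by simp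
  then show ?thesis by simp
qed

text \<open>Fixing the first point is dual to wedging with that point from the left; it supplies the
  second test function of the homotopy.\<close>

lemma alternating_Cons: "alternating \<psi> \<Longrightarrow> alternating (\<lambda>xs. \<psi> (x # xs))"
  unfolding alternating_def
  by (metis permute_list_transpose_Suc length_Cons Suc_less_eq nat.inject)

lemma alternating_map: "alternating \<psi> \<Longrightarrow> alternating (\<lambda>xs. \<psi> (map f xs))"
  unfolding alternating_def
  by (metis permute_list_map transpose_permutes_lessThan length_map)

text \<open>The Leibniz expansion of the determinant of the Kronecker deltas between
  \<open>ys\<close> and \<open>xs\<close>, and 0 if the lengths differ. For distinct
  \<open>ys\<close> it is the coordinate function dual to the wedge of \<open>ys\<close>.\<close>

definition alt_delta :: "nat list \<Rightarrow> nat list \<Rightarrow> 'k::field" where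
  "alt_delta ys xs = (\<Sum>\<sigma> | \<sigma> permutes {..<length ys}.
     if permute_list \<sigma> ys = xs then of_int (sign \<sigma>) else 0)"

lemma alternating_alt_delta: "alternating (alt_delta ys)"
  unfolding alternating_def
proof (intro allI impI)
  fix xs :: "nat list" and i j
  assume ij: "i < length xs" "j < length xs" "i \<noteq> j"
  let ?\<tau> = "transpose i j"
  let ?P = "{\<sigma>. \<sigma> permutes {..<length ys}}"
  show "alt_delta ys (permute_list ?\<tau> xs) = - (alt_delta ys xs :: 'a)"
  proof (cases "length xs = length ys")
    case True
    then have tp: "?\<tau> permutes {..<length ys}"
      using ij by (simp add: transpose_permutes_lessThan)
    \<comment> \<open>Right multiplication by the transposition permutes the summands; it keeps the
      condition of each summand and reverses its sign.\<close>
    have "alt_delta ys (permute_list ?\<tau> xs) = (\<Sum>\<sigma>\<in>?P.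
        if permute_list (\<sigma> \<circ> ?\<tau>) ys = permute_list ?\<tau> xs
        then of_int (sign (\<sigma> \<circ> ?\<tau>)) else (0::'a))"
      unfolding alt_delta_def
      by (rule sum_permutations_compose_right[OF tp])
    also have "\<dots> = (\<Sum>\<sigma>\<in>?P. - (if permute_list \<sigma> ys = xs then of_int (sign \<sigma>) else 0))"
    proof (rule sum.cong)
      fix \<sigma> assume s: "\<sigma> \<in> ?P"
      have "permute_list (\<sigma> \<circ> ?\<tau>) ys = permute_list ?\<tau> (permute_list \<sigma> ys)"
        using tp by (simp add: permute_list_compose)
      then have "permute_list (\<sigma> \<circ> ?\<tau>) ys = permute_list ?\<tau> xs \<longleftrightarrow> permute_list \<sigma> ys = xs"
        using permute_list_inv(2)[of ?\<tau>] tp True by (metis length_permute_list)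
      moreover have "sign (\<sigma> \<circ> ?\<tau>) = - sign \<sigma>"
        using s tp ij by (subst sign_compose)
          (auto simp: sign_swap_id permutation_swap_id permutation_permutes intro: exI[of _ "{..<length ys}"])
      ultimately show "(if permute_list (\<sigma> \<circ> ?\<tau>) ys = permute_list ?\<tau> xs
        then of_int (sign (\<sigma> \<circ> ?\<tau>)) else (0::'a)) =
        - (if permute_list \<sigma> ys = xs then of_int (sign \<sigma>) else 0)" by simp
    qed simp
    finally show ?thesis by (simp add: alt_delta_def sum_negf)
  next
    case False
    then have "permute_list \<sigma> ys \<noteq> xs" "permute_list \<sigma> ys \<noteq> permute_list ?\<tau> xs" for \<sigma>
      by (metis length_permute_list)+
    then show ?thesis
      by (simp add: alt_delta_def)
  qed
qed

lemma alt_delta_self: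
  assumes "distinct ys"
  shows "alt_delta ys ys = (1::'k::field)"
proof -
  have "permute_list \<sigma> ys = ys \<longleftrightarrow> \<sigma> = id" if "\<sigma> permutes {..<length ys}" for \<sigma>
  proof
    assume eq: "permute_list \<sigma> ys = ys"
    show "\<sigma> = id"
    proof
      fix i
      show "\<sigma> i = id i"
      proof (cases "i < length ys")
        case True
        then have "ys ! \<sigma> i = ys ! i"
          using eq permute_list_nth[OF that] by metis
        moreover have "\<sigma> i < length ys"
          using permutes_in_image[OF that] True by simp
        ultimately show ?thesis
          using assms True by (simp add: nth_eq_iff_index_eq)
      qed (use that in \<open>simp add: permutes_def\<close>)
    qed
  qed simp
  then have "alt_delta ys ys = (\<Sum>\<sigma> | \<sigma> permutes {..<length ys}. if \<sigma> = id then 1 else (0::'k))"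
    unfolding alt_delta_def by (intro sum.cong) auto
  also have "\<dots> = 1"
    by (simp add: sum.delta finite_permutations permutes_id)
  finally show ?thesis .
qed

text \<open>The linear functional on the tensor power with value \<psi> xs on the basis tensor of
  \<open>xs\<close>, evaluated at \<phi>.\<close>

definition pairing :: "nat set \<Rightarrow> nat \<Rightarrow> (nat list \<Rightarrow> 'k::field) \<Rightarrow> (nat list \<Rightarrow> 'k) \<Rightarrow> 'k" where
  "pairing X n \<psi> \<phi> = (\<Sum>xs\<in>lists_on X n. \<phi> xs * \<psi> xs)"

lemma pairing_add: "pairing X n \<psi> (u + v) = pairing X n \<psi> u + pairing X n \<psi> v"
  by (simp add: pairing_def algebra_simps sum.distrib)

lemma pairing_fsc: "pairing X n \<psi> (fsc c u) = c * pairing X n \<psi> u"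
  by (simp add: pairing_def fsc_def algebra_simps sum_distrib_left)

lemma pairing_0: "pairing X n \<psi> 0 = 0"
  by (simp add: pairing_def)

lemma pairing_minus: "pairing X n \<psi> (- u) = - pairing X n \<psi> u"
  by (simp add: pairing_def sum_negf)

lemma pairing_diff: "pairing X n \<psi> (u - v) = pairing X n \<psi> u - pairing X n \<psi> v"
  by (simp add: pairing_def algebra_simps sum_subtractf)

lemma pairing_sum: "pairing X n \<psi> (\<Sum>i\<in>I. f i) = (\<Sum>i\<in>I. pairing X n \<psi> (f i))"
  unfolding pairing_def sum_fun_apply sum_distrib_right by (rule sum.swap)

lemma permact_eq: "permact \<sigma> \<phi> = (\<lambda>ys. \<phi> (permute_list \<sigma> ys))"
  by (simp add: permact_def permute_list_def)

lemma of_int_sign_mult_self: "of_int (sign \<sigma>) * of_int (sign \<sigma>) = (1::'k::ring_1)"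
  by (auto simp: sign_def)

text \<open>Reindexing the sum moves the permutation from the vector to \<psi>, which answers with a
  sign; signs are their own inverses.\<close>

lemma pairing_permact:
  assumes "alternating \<psi>" "\<sigma> permutes {..<n}"
  shows "pairing X n \<psi> (permact \<sigma> \<phi>) = of_int (sign \<sigma>) * pairing X n \<psi> \<phi>"
proof -
  have "pairing X n \<psi> (permact \<sigma> \<phi>)
      = (\<Sum>xs\<in>lists_on X n. of_int (sign \<sigma>) * (\<phi> (permute_list \<sigma> xs) * \<psi> (permute_list \<sigma> xs)))"
    unfolding pairing_def permact_eq
  proof (rule sum.cong)
    fix xs assume "xs \<in> lists_on X n"
    then have "\<psi> (permute_list \<sigma> xs) = of_int (sign \<sigma>) * \<psi> xs"
      using assms by (intro alternating_permute) (auto simp: lists_on_def)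
    then show "\<phi> (permute_list \<sigma> xs) * \<psi> xs
        = of_int (sign \<sigma>) * (\<phi> (permute_list \<sigma> xs) * \<psi> (permute_list \<sigma> xs))"
      using of_int_sign_mult_self[of \<sigma>, where 'k = 'a] by (auto simp: algebra_simps)
  qed simp
  also have "\<dots> = of_int (sign \<sigma>) * pairing X n \<psi> \<phi>"
    unfolding sum_distrib_left[symmetric] pairing_def
    by (subst sum_lists_on_permute[OF assms(2), of "\<lambda>xs. \<phi> xs * \<psi> xs"]) simp
  finally show ?thesis .
qed

section \<open>Antisymmetrization and the test for sign relations\<close>

definition antisymmetrize :: "nat \<Rightarrow> (nat list \<Rightarrow> 'k::field) \<Rightarrow> nat list \<Rightarrow> 'k" where
  "antisymmetrize n v = (\<Sum>\<sigma> | \<sigma> permutes {..<n}. fsc (of_int (sign \<sigma>)) (permact \<sigma> v))"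

lemma PtensD: "v \<in> Ptens n X \<Longrightarrow> xs \<notin> lists_on X n \<Longrightarrow> v xs = 0"
  by (auto simp: Ptens_def)

lemma subspace_Ptens: "fsc.subspace (Ptens n X)"
  by (auto simp: fsc.subspace_def Ptens_def fsc_def) (metis add.right_neutral)

lemma permact_Ptens:
  assumes "v \<in> Ptens n X" "\<sigma> permutes {..<n}"
  shows "permact \<sigma> v \<in> Ptens n X"
proof -
  have "ys \<in> lists_on X n" if "permute_list \<sigma> ys \<in> lists_on X n" for ys
    using that assms(2) by (auto simp: lists_on_def)
  then show ?thesis using assms(1) by (auto simp: Ptens_def permact_eq)
qed

text \<open>Exchanging the two sums leaves one list for each permutation. A rearrangement of
  \<open>ys\<close> with entries outside \<open>X\<close> contributes nothing on either side, by the
  support condition on \<open>v\<close>.\<close>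

lemma antisymmetrize_eq_pairing:
  assumes "finite X" "v \<in> Ptens n X" "length ys = n"
  shows "antisymmetrize n v ys = pairing X n (alt_delta ys) v"
proof -
  have "pairing X n (alt_delta ys) v = (\<Sum>\<sigma> | \<sigma> permutes {..<n}. \<Sum>xs\<in>lists_on X n.
      if xs = permute_list \<sigma> ys then of_int (sign \<sigma>) * v xs else 0)"
    unfolding pairing_def alt_delta_def sum_distrib_left assms(3)
    by (subst sum.swap) (auto intro!: sum.cong)
  also have "\<dots> = (\<Sum>\<sigma> | \<sigma> permutes {..<n}. of_int (sign \<sigma>) * v (permute_list \<sigma> ys))"
    using assms by (intro sum.cong) (auto simp: sum.delta PtensD)
  finally show ?thesis
    by (simp add: antisymmetrize_def sum_fun_apply fsc_apply permact_eq)
qed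

lemma pairing_sgn_rel:
  assumes "alternating \<psi>" "v \<in> sgn_rel n V"
  shows "pairing X n \<psi> v = 0"
  using assms(2) unfolding sgn_rel_def
proof (induction rule: fsc.span_induct_alt)
  case (step c x y)
  then show "pairing X n \<psi> (fsc c x + y) = 0"
    using assms(1)
    by (auto simp: pairing_add pairing_fsc pairing_diff pairing_permact mult.assoc[symmetric]
        of_int_sign_mult_self)
qed (rule pairing_0)

lemma sgn_rel_subset:
  assumes "fsc.subspace V" "\<And>\<sigma> v. \<sigma> permutes {..<n} \<Longrightarrow> v \<in> V \<Longrightarrow> permact \<sigma> v \<in> V"
  shows "sgn_rel n V \<subseteq> V"
  unfolding sgn_rel_def
  by (rule fsc.span_minimal)
    (use assms in \<open>auto intro!: fsc.subspace_diff fsc.subspace_scale\<close>)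

text \<open>The average over all permutations of the defining relations of \<open>v\<close>.\<close>

lemma diff_antisymmetrize_in_sgn_rel:
  fixes v :: "nat list \<Rightarrow> 'k::field_char_0"
  assumes "v \<in> V"
  shows "v - fsc (1 / fact n) (antisymmetrize n v) \<in> sgn_rel n V"
proof -
  let ?P = "{\<sigma>. \<sigma> permutes {..<n}}"
  have card: "card ?P = fact n" using card_permutations[of "{..<n}" n] by simp
  have "fsc (1 / fact n) (\<Sum>\<sigma>\<in>?P. v - fsc (of_int (sign \<sigma>)) (permact \<sigma> v))
      = v - fsc (1 / fact n) (antisymmetrize n v)"
  proof
    fix xs
    have "(\<Sum>\<sigma>\<in>?P. v xs) = fact n * v xs" using card by simp
    then show "fsc (1 / fact n) (\<Sum>\<sigma>\<in>?P. v - fsc (of_int (sign \<sigma>)) (permact \<sigma> v)) xs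
        = (v - fsc (1 / fact n) (antisymmetrize n v)) xs"
      by (simp add: fsc_apply antisymmetrize_def sum_fun_apply sum_subtractf right_diff_distrib
          del: sum_constant)
  qed
  moreover have "fsc (1 / fact n) (\<Sum>\<sigma>\<in>?P. v - fsc (of_int (sign \<sigma>)) (permact \<sigma> v)) \<in> sgn_rel n V"
    unfolding sgn_rel_def
    by (intro fsc.span_scale fsc.span_sum, rule fsc.span_base) (use assms in auto)
  ultimately show ?thesis by simp
qed

text \<open>The functions \<open>alt_delta ys\<close> read off all coordinates of the
  antisymmetrization. If they vanish, it is zero, and \<open>v\<close> equals its own difference
  from it, which is a combination of relations.\<close>

lemma sgn_relI:
  fixes v :: "nat list \<Rightarrow> 'k::field_char_0"
  assumes "v \<in> V" "finite X" "V \<subseteq> Ptens n X"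
    and "\<And>ys. length ys = n \<Longrightarrow> pairing X n (alt_delta ys) v = 0"
  shows "v \<in> sgn_rel n V"
proof -
  have v: "v \<in> Ptens n X" using assms by auto
  have "antisymmetrize n v ys = 0" for ys
  proof (cases "length ys = n")
    case False
    then have "permute_list \<sigma> ys \<notin> lists_on X n" for \<sigma> by (simp add: lists_on_def)
    then show ?thesis
      using PtensD[OF v] by (simp add: antisymmetrize_def sum_fun_apply fsc_apply permact_eq)
  qed (use assms v in \<open>simp add: antisymmetrize_eq_pairing\<close>)
  then have "antisymmetrize n v = 0" by auto
  then show ?thesis using diff_antisymmetrize_in_sgn_rel[OF assms(1), of n] by simp
qed

section \<open>Decomposable tensors\<close>

lemma tensorl_Nil: "tensorl [] = (\<lambda>ys. if ys = [] then 1 else 0)"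
  by (auto simp: tensorl_def)

lemma tensorl_Cons: "tensorl (u # us) (y # ys) = u [y] * tensorl us ys"
  by (simp add: tensorl_def prod.lessThan_Suc_shift del: prod.lessThan_Suc)

lemma tensorl_length: "length ys \<noteq> length us \<Longrightarrow> tensorl us ys = 0"
  by (simp add: tensorl_def)

lemma tensorl_permute_list:
  assumes "\<sigma> permutes {..<length us}" "length ys = length us"
  shows "tensorl (permute_list \<sigma> us) (permute_list \<sigma> ys) = tensorl us ys"
proof -
  have "(\<Prod>i<length us. (us ! i) [ys ! i]) = (\<Prod>i<length us. (us ! \<sigma> i) [ys ! \<sigma> i])"
    using prod.permute[OF assms(1), of "\<lambda>i. (us ! i) [ys ! i]"] by (simp add: comp_def)
  also have "\<dots> = (\<Prod>i<length us. (permute_list \<sigma> us ! i) [permute_list \<sigma> ys ! i])"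
    using assms by (intro prod.cong) (auto simp: permute_list_nth)
  finally show ?thesis using assms by (simp add: tensorl_def)
qed

text \<open>The inverse appears because \<open>permact\<close> permutes the arguments, while
  permuting arguments and factors together changes nothing.\<close>

lemma permact_tensorl:
  assumes "\<sigma> permutes {..<length us}"
  shows "permact \<sigma> (tensorl us) = tensorl (permute_list (inv \<sigma>) us)"
proof
  fix ys
  show "permact \<sigma> (tensorl us) ys = tensorl (permute_list (inv \<sigma>) us) ys"
  proof (cases "length ys = length us")
    case True
    then have "tensorl us (permute_list \<sigma> ys)
        = tensorl (permute_list (inv \<sigma>) us) (permute_list (inv \<sigma>) (permute_list \<sigma> ys))"
      using assms by (subst tensorl_permute_list) (auto simp: permutes_inv)
    then show ?thesis
      using permute_list_inv(2)[of \<sigma> ys] True assms by (simp add: permact_eq)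
  qed (simp add: permact_eq tensorl_length)
qed

lemma tensorl_add:
  "tensorl (as @ (u + v) # bs) = tensorl (as @ u # bs) + tensorl (as @ v # bs)"
proof
  fix ys
  show "tensorl (as @ (u + v) # bs) ys = (tensorl (as @ u # bs) + tensorl (as @ v # bs)) ys"
  proof (induction as arbitrary: ys)
    case Nil
    then show ?case by (cases ys) (auto simp: tensorl_Cons tensorl_length algebra_simps)
  next
    case (Cons a as)
    then show ?case by (cases ys) (auto simp: tensorl_Cons tensorl_length algebra_simps)
  qed
qed

lemma tensorl_uminus: "tensorl (as @ (- u) # bs) = - tensorl (as @ u # bs)"
proof
  fix ys
  show "tensorl (as @ (- u) # bs) ys = (- tensorl (as @ u # bs)) ys"
  proof (induction as arbitrary: ys)
    case Nil
    then show ?case by (cases ys) (auto simp: tensorl_Cons tensorl_length algebra_simps)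
  next
    case (Cons a as)
    then show ?case by (cases ys) (auto simp: tensorl_Cons tensorl_length algebra_simps)
  qed
qed

lemma tensorl_map_ev: "tensorl (map ev xs) ys = (if ys = xs then 1 else 0)"
proof (induction xs arbitrary: ys)
  case Nil
  then show ?case by (simp add: tensorl_Nil)
next
  case (Cons x xs)
  then show ?case by (cases ys) (auto simp: tensorl_Cons tensorl_length ev_def)
qed

lemma Ptens_expand:
  assumes "finite X" "v \<in> Ptens n X"
  shows "v = (\<Sum>xs\<in>lists_on X n. fsc (v xs) (tensorl (map ev xs)))"
proof
  fix ys
  have "(\<Sum>xs\<in>lists_on X n. v xs * (if ys = xs then 1 else 0)) = v ys"
    using assms by (simp add: PtensD if_distrib sum.delta cong: if_cong)
  then show "v ys = (\<Sum>xs\<in>lists_on X n. fsc (v xs) (tensorl (map ev xs))) ys"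
    by (simp add: sum_fun_apply fsc_apply tensorl_map_ev)
qed

lemma tensorl_Ptens:
  assumes "set us \<subseteq> Ptens 1 X"
  shows "tensorl us \<in> Ptens (length us) X"
proof -
  have "ys \<in> lists_on X (length us)" if "tensorl us ys \<noteq> 0" for ys
    using that assms
  proof (induction us arbitrary: ys)
    case Nil
    then show ?case by (auto simp: tensorl_Nil split: if_splits)
  next
    case (Cons u us)
    then obtain z zs where "ys = z # zs" "u [z] \<noteq> 0" "tensorl us zs \<noteq> 0"
      by (cases ys) (auto simp: tensorl_Cons tensorl_length)
    with Cons show ?case by (force simp: Ptens_def lists_on_def)
  qed
  then show ?thesis by (auto simp: Ptens_def)
qed

lemma ev_Ptens: "x \<in> X \<Longrightarrow> ev x \<in> Ptens 1 X"
  by (auto simp: Ptens_def ev_def lists_on_def)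

lemma basis_Ptens: "xs \<in> lists_on X n \<Longrightarrow> tensorl (map ev xs) \<in> Ptens n X"
  by (auto simp: Ptens_def tensorl_map_ev)

text \<open>An alternating function on lists of points induces an alternating multilinear function
  on lists of vectors.\<close>

lemma pairing_tensorl_repeat:
  fixes \<psi> :: "nat list \<Rightarrow> 'k::field_char_0"
  assumes "alternating \<psi>" "\<not> distinct us"
  shows "pairing X (length us) \<psi> (tensorl us) = 0"
proof -
  obtain i j where ij: "i < length us" "j < length us" "i \<noteq> j" "us ! i = us ! j"
    using assms(2) by (auto simp: distinct_conv_nth)
  have tp: "transpose i j permutes {..<length us}"
    using ij by (simp add: transpose_permutes_lessThan)
  have "permact (transpose i j) (tensorl us) = tensorl us"
    using permact_tensorl[OF tp] ij by (simp add: permute_list_transpose_eq)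
  then have "pairing X (length us) \<psi> (tensorl us) = - pairing X (length us) \<psi> (tensorl us)"
    using pairing_permact[OF assms(1) tp, of X "tensorl us"] ij by (simp add: sign_swap_id)
  then show ?thesis by simp
qed

lemma pairing_tensorl_transpose:
  assumes "alternating \<psi>" "i < length us" "j < length us" "i \<noteq> j"
  shows "pairing X (length us) \<psi> (tensorl (permute_list (transpose i j) us))
    = - pairing X (length us) \<psi> (tensorl us)"
proof -
  have tp: "transpose i j permutes {..<length us}"
    using assms by (simp add: transpose_permutes_lessThan)
  show ?thesis
    using pairing_permact[OF assms(1) tp, of X "tensorl us"] permact_tensorl[OF tp] assms
    by (simp add: sign_swap_id)
qed

text \<open>The column operation of determinants: each added \<open>d\<close> contributes a tensor
  with a repeated factor, which \<psi> kills. As \<open>d\<close> sits outside \<open>bs\<close>,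
  each processed vector can join \<open>as\<close> in the induction.\<close>

lemma pairing_tensorl_shift:
  fixes \<psi> :: "nat list \<Rightarrow> 'k::field_char_0"
  assumes "alternating \<psi>" "d \<in> set as \<union> set cs" "n = length as + length bs + length cs"
  shows "pairing X n \<psi> (tensorl (as @ map (\<lambda>u. u + d) bs @ cs))
    = pairing X n \<psi> (tensorl (as @ bs @ cs))"
  using assms(2,3)
proof (induction bs arbitrary: as)
  case (Cons b bs)
  let ?bs = "map (\<lambda>u. u + d) bs"
  have "pairing X n \<psi> (tensorl (as @ (b + d) # ?bs @ cs))
      = pairing X n \<psi> (tensorl (as @ b # ?bs @ cs)) + pairing X n \<psi> (tensorl (as @ d # ?bs @ cs))"
    by (simp add: tensorl_add pairing_add)
  also have "pairing X n \<psi> (tensorl (as @ d # ?bs @ cs)) = 0"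
    using pairing_tensorl_repeat[OF assms(1), of "as @ d # ?bs @ cs" X] Cons.prems
    by (auto simp: add.assoc)
  also have "pairing X n \<psi> (tensorl (as @ b # ?bs @ cs))
      = pairing X n \<psi> (tensorl (as @ b # bs @ cs))"
    using Cons.IH[of "as @ [b]"] Cons.prems by (simp del: plus_fun_apply)
  finally show ?case by simp
qed simp

lemma pairing_tensorl_ev:
  assumes "finite X" "xs \<in> lists_on X n"
  shows "pairing X n \<psi> (tensorl (map ev xs)) = \<psi> xs"
  using assms by (simp add: pairing_def tensorl_map_ev if_distrib if_distribR sum.delta cong: if_cong)

lemma pairing_tensorl_Cons:
  "pairing X (Suc n) \<psi> (tensorl (u # us)) = (\<Sum>x\<in>X. u [x] * pairing X n (\<lambda>xs. \<psi> (x # xs)) (tensorl us))"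
  by (simp add: pairing_def sum_lists_on_Suc tensorl_Cons sum_distrib_left mult.assoc)

lemma pairing_tensorl_ev_Cons:
  assumes "finite X" "x \<in> X"
  shows "pairing X (Suc n) \<psi> (tensorl (ev x # us)) = pairing X n (\<lambda>xs. \<psi> (x # xs)) (tensorl us)"
proof -
  have "ev x [y] * c = (if y = x then c else 0)" for y and c :: 'a
    by (simp add: ev_def)
  then show ?thesis using assms by (simp add: pairing_tensorl_Cons sum.delta)
qed

section \<open>Functoriality\<close>

lemma push_eq: "push X f \<phi> ys = (\<Sum>xs\<in>lists_on X (length ys). \<phi> xs * of_bool (map f xs = ys))"
  unfolding push_def by (intro sum.cong) auto

lemma push_add: "push X f (u + v) = push X f u + push X f v"
  by (rule ext) (simp add: push_eq algebra_simps sum.distrib)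

lemma push_diff: "push X f (u - v) = push X f u - push X f v"
  by (rule ext) (simp add: push_eq algebra_simps sum_subtractf)

lemma push_fsc: "push X f (fsc c u) = fsc c (push X f u)"
  by (rule ext) (simp add: push_eq fsc_apply mult.assoc sum_distrib_left)

lemma push_0: "push X f 0 = 0"
  by (rule ext) (simp add: push_eq)

lemma push_sum: "push X f (\<Sum>i\<in>I. g i) = (\<Sum>i\<in>I. push X f (g i))"
proof
  fix ys
  have "push X f (\<Sum>i\<in>I. g i) ys
      = (\<Sum>xs\<in>lists_on X (length ys). \<Sum>i\<in>I. if map f xs = ys then g i xs else 0)"
    unfolding push_def sum_fun_apply by (intro sum.cong) auto
  then show "push X f (\<Sum>i\<in>I. g i) ys = (\<Sum>i\<in>I. push X f (g i)) ys"
    unfolding sum_fun_apply push_def by (subst (asm) sum.swap)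
qed

lemma map_in_lists_on: "f \<in> X \<rightarrow> Y \<Longrightarrow> xs \<in> lists_on X n \<Longrightarrow> map f xs \<in> lists_on Y n"
  by (auto simp: lists_on_def)

lemma push_Ptens:
  assumes "v \<in> Ptens n X" "f \<in> X \<rightarrow> Y"
  shows "push X f v \<in> Ptens n Y"
  unfolding Ptens_def mem_Collect_eq
proof (intro allI impI)
  fix ys assume "push X f v ys \<noteq> 0"
  then obtain xs where "xs \<in> lists_on X (length ys)" "v xs * of_bool (map f xs = ys) \<noteq> 0"
    unfolding push_eq by (rule sum.not_neutral_contains_not_neutral)
  then have "xs \<in> lists_on X n" "map f xs = ys" using assms(1) by (auto simp: Ptens_def)
  then show "ys \<in> lists_on Y n" using assms(2) map_in_lists_on by blast
qed

lemma push_id: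
  assumes "finite X" "v \<in> Ptens n X"
  shows "push X (restrict id X) v = v"
proof
  fix ys :: "nat list"
  have "map (restrict id X) xs = xs" if "xs \<in> lists_on X (length ys)" for xs
    using that by (auto simp: lists_on_def intro!: map_idI)
  then have "push X (restrict id X) v ys = (\<Sum>xs\<in>lists_on X (length ys). if xs = ys then v xs else 0)"
    unfolding push_def by (intro sum.cong) auto
  also have "\<dots> = v ys"
    using assms PtensD[OF assms(2), of ys] by (auto simp: sum.delta lists_on_def[of X n])
      (auto simp: lists_on_def)
  finally show "push X (restrict id X) v ys = v ys" .
qed

lemma push_compose:
  assumes "finite X" "finite Y" "f \<in> X \<rightarrow> Y"
  shows "push X (compose X g f) v = push Y g (push X f v)"
proof
  fix zs :: "nat list"
  let ?n = "length zs"
  have eq: "map (compose X g f) xs = map g (map f xs)" if "xs \<in> lists_on X ?n" for xs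
    using that by (auto simp: lists_on_def compose_def)
  have "push Y g (push X f v) zs = (\<Sum>ys\<in>lists_on Y ?n. \<Sum>xs\<in>lists_on X ?n.
      if ys = map f xs then (if map g ys = zs then v xs else 0) else 0)"
    unfolding push_def
  proof (intro sum.cong refl)
    fix ys assume "ys \<in> lists_on Y ?n"
    then have "length ys = ?n" by (simp add: lists_on_def)
    then show "(if map g ys = zs then
        (\<Sum>xs\<in>lists_on X (length ys). if map f xs = ys then v xs else 0) else 0)
      = (\<Sum>xs\<in>lists_on X ?n. if ys = map f xs then (if map g ys = zs then v xs else 0) else 0)"
      by (cases "map g ys = zs") (simp_all add: eq_commute[of ys] cong: if_cong)
  qed
  also have "\<dots> = (\<Sum>xs\<in>lists_on X ?n. \<Sum>ys\<in>lists_on Y ?n.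
      if ys = map f xs then (if map g ys = zs then v xs else 0) else 0)"
    by (rule sum.swap)
  also have "\<dots> = (\<Sum>xs\<in>lists_on X ?n. if map g (map f xs) = zs then v xs else 0)"
    using assms map_in_lists_on[OF assms(3)] by (intro sum.cong) (auto simp: sum.delta)
  also have "\<dots> = push X (compose X g f) v zs"
    unfolding push_def using eq by (intro sum.cong) auto
  finally show "push X (compose X g f) v zs = push Y g (push X f v) zs" ..
qed

lemma push_tensorl: "push X f (tensorl us) = tensorl (map (push X f) us)"
proof
  fix ys
  show "push X f (tensorl us) ys = tensorl (map (push X f) us) ys"
  proof (induction us arbitrary: ys)
    case Nil
    then show ?case
      by (cases ys) (auto simp: push_def tensorl_Nil sum_lists_on_Suc intro!: sum.neutral)
  next
    case (Cons u us)
    note IH = Cons.IH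
    show ?case
    proof (cases ys)
      case Nil
      then show ?thesis by (simp add: push_def tensorl_length)
    next
      case (Cons z zs)
      have "push X f (tensorl (u # us)) (z # zs) = (\<Sum>x\<in>X. \<Sum>xs\<in>lists_on X (length zs).
          (if f x = z then u [x] else 0) * (if map f xs = zs then tensorl us xs else 0))"
        by (auto simp: push_def sum_lists_on_Suc tensorl_Cons intro!: sum.cong)
      also have "\<dots> = push X f u [z] * push X f (tensorl us) zs"
        by (simp add: push_def sum_lists_on_1 sum_product)
      finally show ?thesis using Cons IH by (simp add: tensorl_Cons)
    qed
  qed
qed

lemma push_ev:
  assumes "finite X" "x \<in> X"
  shows "push X f (ev x) = (ev (f x) :: nat list \<Rightarrow> 'k::field)"
proof
  fix ys
  show "push X f (ev x) ys = (ev (f x) ys :: 'k)"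
  proof (cases "\<exists>y. ys = [y]")
    case True
    then obtain y where "ys = [y]" by blast
    moreover have "(\<Sum>z\<in>X. if f z = y then ev x [z] else (0::'k))
        = (\<Sum>z\<in>X. if z = x then (if f x = y then 1 else 0) else 0)"
      by (intro sum.cong) (auto simp: ev_def)
    ultimately show ?thesis using assms
      by (simp add: push_def sum_lists_on_1 sum.delta) (auto simp: ev_def)
  next
    case False
    then have "length ys \<noteq> 1" by (metis One_nat_def length_0_conv length_Suc_conv)
    then have "ev x xs = (0::'k)" if "xs \<in> lists_on X (length ys)" for xs
      using that by (auto simp: ev_def lists_on_def)
    moreover have "ev (f x) ys = (0::'k)" using False by (simp add: ev_def)
    ultimately show ?thesis by (auto simp: push_def intro!: sum.neutral)
  qed
qed

lemma push_permact:
  assumes "v \<in> Ptens n X" "\<sigma> permutes {..<n}"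
  shows "push X f (permact \<sigma> v) = permact \<sigma> (push X f v)"
proof
  fix ys
  show "push X f (permact \<sigma> v) ys = permact \<sigma> (push X f v) ys"
  proof (cases "length ys = n")
    case True
    have inj: "map f xs = ys \<longleftrightarrow> map f (permute_list \<sigma> xs) = permute_list \<sigma> ys"
      if "xs \<in> lists_on X n" for xs
    proof -
      have len: "length xs = n" using that by (simp add: lists_on_def)
      have "permute_list \<sigma> (map f xs) = permute_list \<sigma> ys \<longleftrightarrow> map f xs = ys"
        using permute_list_inv(2)[of \<sigma> "map f xs"] permute_list_inv(2)[of \<sigma> ys] len True assms(2)
        by (metis length_map)
      then show ?thesis using permute_list_map[of \<sigma> xs f] len assms(2) by simp
    qed
    have "push X f (permact \<sigma> v) ys = (\<Sum>xs\<in>lists_on X n.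
        if map f (permute_list \<sigma> xs) = permute_list \<sigma> ys then v (permute_list \<sigma> xs) else 0)"
      unfolding push_def permact_eq True by (intro sum.cong) (auto simp: inj)
    also have "\<dots> = permact \<sigma> (push X f v) ys"
      unfolding push_def permact_eq length_permute_list True
      by (rule sum_lists_on_permute[OF assms(2)])
    finally show ?thesis .
  next
    case False
    then have "v xs = 0" if "length xs = length ys" for xs
      using that assms(1) by (intro PtensD[OF assms(1)]) (auto simp: lists_on_def)
    then have "push X f (permact \<sigma> v) ys = 0" "push X f v (permute_list \<sigma> ys) = 0"
      unfolding push_def permact_eq by (auto simp: lists_on_def intro!: sum.neutral)
    then show ?thesis by (simp add: permact_eq)
  qed
qed

text \<open>Pushing vectors forward is the transpose of pulling functions back along
  \<open>map f\<close>, so claims about \<open>push\<close> reduce to stability of the test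
  functions under pullback.\<close>

lemma pairing_push:
  assumes "finite X" "finite Y" "f \<in> X \<rightarrow> Y"
  shows "pairing Y n \<psi> (push X f v) = pairing X n (\<lambda>xs. \<psi> (map f xs)) v"
proof -
  have "pairing Y n \<psi> (push X f v) = (\<Sum>ys\<in>lists_on Y n. \<Sum>xs\<in>lists_on X n.
      if ys = map f xs then v xs * \<psi> ys else 0)"
    unfolding pairing_def push_def sum_distrib_right
    by (intro sum.cong refl) (auto simp: lists_on_def intro!: sum.cong)
  also have "\<dots> = (\<Sum>xs\<in>lists_on X n. \<Sum>ys\<in>lists_on Y n.
      if ys = map f xs then v xs * \<psi> ys else 0)"
    by (rule sum.swap)
  also have "\<dots> = pairing X n (\<lambda>xs. \<psi> (map f xs)) v"
    unfolding pairing_def using assms map_in_lists_on[OF assms(3)]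
    by (intro sum.cong) (auto simp: sum.delta)
  finally show ?thesis .
qed

lemma push_antisymmetrize:
  assumes "v \<in> Ptens n X"
  shows "push X f (antisymmetrize n v) = antisymmetrize n (push X f v)"
  using assms by (simp add: antisymmetrize_def push_sum push_fsc push_permact)

section \<open>Exterior powers of subfunctors of tensor powers\<close>

text \<open>Both exterior powers of the theorem arise from a permutation-stable subfunctor of the
  tensor power of the first standard projective.\<close>

locale tensor_subfunctor =
  fixes n :: nat and V :: "nat set \<Rightarrow> (nat list \<Rightarrow> 'k::field_char_0) set"
  assumes subspace_V: "finite X \<Longrightarrow> fsc.subspace (V X)"
    and V_Ptens: "finite X \<Longrightarrow> V X \<subseteq> Ptens n X"
    and permact_V: "finite X \<Longrightarrow> \<sigma> permutes {..<n} \<Longrightarrow> v \<in> V X \<Longrightarrow> permact \<sigma> v \<in> V X"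
    and push_V: "FA_hom X Y f \<Longrightarrow> v \<in> V X \<Longrightarrow> push X f v \<in> V Y"
begin

lemma sgn_rel_V: "finite X \<Longrightarrow> sgn_rel n (V X) \<subseteq> V X"
  using sgn_rel_subset[OF subspace_V, of X n] permact_V by blast

lemma mem_sgn_rel_iff:
  assumes "finite X"
  shows "v \<in> sgn_rel n (V X) \<longleftrightarrow> v \<in> V X \<and> (\<forall>\<psi>. alternating \<psi> \<longrightarrow> pairing X n \<psi> v = 0)"
  using sgn_rel_V[OF assms] pairing_sgn_rel[of _ v n "V X" X]
    sgn_relI[OF _ assms V_Ptens[OF assms], of v] alternating_alt_delta by blast

lemma push_sgn_rel:
  assumes "FA_hom X Y f" "v \<in> sgn_rel n (V X)"
  shows "push X f v \<in> sgn_rel n (V Y)"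
proof -
  have fin: "finite X" "finite Y" and f: "f \<in> X \<rightarrow> Y"
    using assms(1) by (auto simp: FA_hom_def)
  show ?thesis
    using assms push_V[OF assms(1)]
    by (auto simp: mem_sgn_rel_iff fin pairing_push[OF fin f] alternating_map)
qed

lemma is_famod:
  "is_famod fsc \<lparr> Mo = V, Nu = (\<lambda>X. sgn_rel n (V X)), act = (\<lambda>X Y f. push X f) \<rparr>"
proof -
  have 2: "fsc.subspace (sgn_rel n (V X))" for X
    unfolding sgn_rel_def by (rule fsc.subspace_span)
  have 3: "push X (restrict id X) v - v \<in> sgn_rel n (V X)" if "finite X" "v \<in> V X" for X v
    using that push_id[of X v n] V_Ptens[of X] fsc.subspace_0[OF 2] by auto
  have 4: "push X (compose X g f) v - push Y g (push X f v) \<in> sgn_rel n (V Z)"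
    if "FA_hom X Y f" "FA_hom Y Z g" for X Y Z f g v
    using that push_compose[of X Y f g v] fsc.subspace_0[OF 2]
    by (auto simp: FA_hom_def PiE_iff Pi_iff)
  show ?thesis
    unfolding is_famod_def famod.simps
    by (intro conjI allI impI ballI vector_space_fsc subspace_V 2 3 4 sgn_rel_V push_V push_sgn_rel)
      (simp_all add: lin_on_def push_add push_fsc)
qed

end

section \<open>Tensor powers of the augmentation kernel\<close>

text \<open>As a pairing with the constant 1, the augmentation is visibly invariant under
  \<open>push\<close>: pullback fixes constants.\<close>

lemma Pbar_iff_pairing: "u \<in> Pbar X \<longleftrightarrow> u \<in> Ptens 1 X \<and> pairing X 1 (\<lambda>_. 1) u = 0"
  by (simp add: Pbar_def pairing_def sum_lists_on_1)

lemma Pbar_Ptens: "u \<in> Pbar X \<Longrightarrow> u \<in> Ptens 1 X"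
  by (simp add: Pbar_def)

lemma push_Pbar:
  assumes "FA_hom X Y f" "u \<in> Pbar X"
  shows "push X f u \<in> Pbar Y"
proof -
  have "finite X" "finite Y" "f \<in> X \<rightarrow> Y"
    using assms(1) by (auto simp: FA_hom_def)
  then show ?thesis
    using assms(2) by (simp add: Pbar_iff_pairing pairing_push push_Ptens)
qed

lemma ev_diff_Pbar:
  assumes "finite X" "x \<in> X" "y \<in> X"
  shows "ev y - ev x \<in> Pbar X"
proof -
  have "pairing X 1 (\<lambda>_. 1) (ev z) = (1::'a)" if "z \<in> X" for z
    using assms(1) that by (simp add: pairing_def sum_lists_on_1 ev_def sum.delta)
  then show ?thesis
    using assms fsc.subspace_diff[OF subspace_Ptens ev_Ptens ev_Ptens]
    by (simp add: Pbar_iff_pairing pairing_diff)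
qed

lemma Ptens_empty: "Ptens (Suc n) {} = {0}"
proof -
  have "lists_on {} (Suc n) = {}" by (auto simp: lists_on_def)
  then show ?thesis by (auto simp: Ptens_def fun_eq_iff)
qed

lemma Ptens_0_eq: "Ptens 0 X = fsc.span {tensorl []}"
proof -
  have "\<phi> \<in> fsc.span {tensorl []}" if "\<phi> \<in> Ptens 0 X" for \<phi> :: "nat list \<Rightarrow> 'a"
  proof -
    have "\<phi> = fsc (\<phi> []) (tensorl [])"
      using that by (auto simp: fun_eq_iff Ptens_def fsc_apply tensorl_Nil)
    then show ?thesis by (metis fsc.span_base fsc.span_scale singletonI)
  qed
  moreover have "fsc.span {tensorl []} \<subseteq> Ptens 0 X"
    using basis_Ptens[of "[]" X 0] by (intro fsc.span_minimal subspace_Ptens) simp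
  ultimately show ?thesis by blast
qed

text \<open>The case distinction of the definition on the tensor degree is really one on the set:
  for non-empty sets the degree 0 convention agrees with the span.\<close>

lemma Pbar_tens_eq:
  "Pbar_tens n X = (if X = {} then {0}
     else fsc.span {tensorl us | us. length us = n \<and> set us \<subseteq> Pbar X})"
proof (cases n)
  case 0
  have "{tensorl us | us :: (nat list \<Rightarrow> 'a) list. length us = n \<and> set us \<subseteq> Pbar X} = {tensorl []}"
    using 0 by auto
  then show ?thesis using 0 by (simp add: Pbar_tens_def Ptens_0_eq)
next
  case (Suc m)
  have "fsc.span {tensorl us | us. length us = n \<and> set us \<subseteq> Pbar {}} = {0 :: nat list \<Rightarrow> 'a}"
  proof -
    have "tensorl us = 0" if "length us = n" "set us \<subseteq> Pbar {}" for us :: "(nat list \<Rightarrow> 'a) list"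
    proof -
      have "tensorl us \<in> Ptens (Suc m) {}"
        using that Suc tensorl_Ptens[of us "{}"] Pbar_Ptens by auto
      then show ?thesis by (simp add: Ptens_empty)
    qed
    then have "{tensorl us | us. length us = n \<and> set us \<subseteq> Pbar {}} \<subseteq> {0 :: nat list \<Rightarrow> 'a}"
      by auto
    then have "fsc.span {tensorl us | us. length us = n \<and> set us \<subseteq> Pbar {}} \<subseteq> {0 :: nat list \<Rightarrow> 'a}"
      by (rule fsc.span_minimal) (rule fsc.subspace_single_0)
    then show ?thesis using fsc.span_zero by blast
  qed
  then show ?thesis using Suc by (simp add: Pbar_tens_def)
qed

lemma subspace_Pbar_tens: "fsc.subspace (Pbar_tens n X)"
  by (simp add: Pbar_tens_eq fsc.subspace_single_0 fsc.subspace_span)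

text \<open>The step provides \<open>X \<noteq> {}\<close>, which in degree 0 does not follow from
  the empty list of factors; thus both cases of the definition are treated at once.\<close>

lemma Pbar_tens_induct [consumes 1, case_names zero step]:
  assumes "v \<in> Pbar_tens n X" "P 0"
    and "\<And>c us v. length us = n \<Longrightarrow> set us \<subseteq> Pbar X \<Longrightarrow> X \<noteq> {} \<Longrightarrow> P v \<Longrightarrow>
      P (fsc c (tensorl us) + v)"
  shows "P v"
proof (cases "X = {}")
  case True
  then show ?thesis using assms by (simp add: Pbar_tens_eq)
next
  case False
  then have "v \<in> fsc.span {tensorl us | us. length us = n \<and> set us \<subseteq> Pbar X}"
    using assms(1) by (simp add: Pbar_tens_eq)
  then show ?thesis
  proof (rule fsc.span_induct_alt)
    show "P 0" by fact
    show "P (fsc c w + v)" if "w \<in> {tensorl us | us. length us = n \<and> set us \<subseteq> Pbar X}" "P v"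
      for c w v
      using that False assms(3) by blast
  qed
qed

lemma tensorl_Pbar_tens:
  "X \<noteq> {} \<Longrightarrow> set us \<subseteq> Pbar X \<Longrightarrow> tensorl us \<in> Pbar_tens (length us) X"
  by (auto simp: Pbar_tens_eq intro!: fsc.span_base)

lemma Pbar_tens_lincomb:
  "u \<in> Pbar_tens n X \<Longrightarrow> v \<in> Pbar_tens n X \<Longrightarrow> fsc c u + v \<in> Pbar_tens n X"
  by (intro fsc.subspace_add[OF subspace_Pbar_tens] fsc.subspace_scale[OF subspace_Pbar_tens])

lemma permact_0: "permact \<sigma> 0 = 0"
  by (simp add: permact_eq fun_eq_iff)

lemma permact_lincomb: "permact \<sigma> (fsc c u + v) = fsc c (permact \<sigma> u) + permact \<sigma> v"
  by (simp add: permact_eq fun_eq_iff fsc_apply)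

lemma tensor_subfunctor_Ptens:
  "tensor_subfunctor n (Ptens n :: nat set \<Rightarrow> (nat list \<Rightarrow> 'k::field_char_0) set)"
  by unfold_locales
    (auto intro: subspace_Ptens permact_Ptens push_Ptens simp: FA_hom_def PiE_iff Pi_iff)

lemma tensor_subfunctor_Pbar_tens:
  "tensor_subfunctor n (Pbar_tens n :: nat set \<Rightarrow> (nat list \<Rightarrow> 'k::field_char_0) set)"
proof
  show "fsc.subspace (Pbar_tens n X :: (nat list \<Rightarrow> 'k) set)" for X
    by (rule subspace_Pbar_tens)
  show "(Pbar_tens n X :: (nat list \<Rightarrow> 'k) set) \<subseteq> Ptens n X" for X
  proof
    fix v :: "nat list \<Rightarrow> 'k" assume "v \<in> Pbar_tens n X"
    then show "v \<in> Ptens n X"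
    proof (induction rule: Pbar_tens_induct)
      case zero
      then show ?case by (rule fsc.subspace_0[OF subspace_Ptens])
    next
      case (step c us v)
      then show ?case
        using tensorl_Ptens[of us X] Pbar_Ptens
        by (intro fsc.subspace_add[OF subspace_Ptens] fsc.subspace_scale[OF subspace_Ptens]) auto
    qed
  qed
  show "permact \<sigma> v \<in> Pbar_tens n X" if "\<sigma> permutes {..<n}" "v \<in> Pbar_tens n X"
    for \<sigma> X and v :: "nat list \<Rightarrow> 'k"
    using that(2)
  proof (induction rule: Pbar_tens_induct)
    case zero
    then show ?case unfolding permact_0 by (rule fsc.subspace_0[OF subspace_Pbar_tens])
  next
    case (step c us v)
    then have "permact \<sigma> (tensorl us) \<in> Pbar_tens n X"
      using that(1) tensorl_Pbar_tens[of X "permute_list (inv \<sigma>) us"]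
      by (simp add: permact_tensorl permutes_inv)
    then show ?case using step(4) unfolding permact_lincomb by (rule Pbar_tens_lincomb)
  qed
  show "push X f v \<in> Pbar_tens n Y" if "FA_hom X Y f" "v \<in> Pbar_tens n X"
    for X Y f and v :: "nat list \<Rightarrow> 'k"
    using that(2)
  proof (induction rule: Pbar_tens_induct)
    case zero
    then show ?case unfolding push_0 by (rule fsc.subspace_0[OF subspace_Pbar_tens])
  next
    case (step c us v)
    \<comment> \<open>In degree 0 this is what makes the empty tensor available over the target: a
      non-empty set only maps to non-empty sets.\<close>
    then have "Y \<noteq> {}" using that(1) by (auto simp: FA_hom_def)
    then have "push X f (tensorl us) \<in> Pbar_tens n Y"
      using step that(1) tensorl_Pbar_tens[of Y "map (push X f) us"] push_Pbar[OF that(1)]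
      by (auto simp: push_tensorl)
    then show ?case using step unfolding push_add push_fsc by (intro Pbar_tens_lincomb)
  qed
qed

section \<open>Contraction with the augmentation\<close>

text \<open>A representative of the boundary of the simplex \<open>xs\<close> with its first vertex
  as base point. Unlike the alternating sum over omitted entries, it always consists of factors in
  P-bar.\<close>

abbreviation diff_tensor :: "nat list \<Rightarrow> nat list \<Rightarrow> 'k::field" where
  "diff_tensor xs \<equiv> tensorl (map (\<lambda>y. ev y - ev (hd xs)) (tl xs))"

lemma pi_map_Suc: "pi_map (Suc n) X \<phi> = (\<Sum>xs\<in>lists_on X (Suc n). fsc (\<phi> xs) (diff_tensor xs))"
  by (simp add: pi_map_def)

lemma pi_map_add: "pi_map n X (u + v) = pi_map n X u + pi_map n X v"
  by (cases n) (auto simp: pi_map_def fsc.scale_left_distrib sum.distrib)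

lemma pi_map_fsc: "pi_map n X (fsc c v) = fsc c (pi_map n X v)"
  by (cases n) (auto simp: pi_map_def fsc.scale_sum_right fsc_apply)

lemma pi_map_0: "pi_map n X 0 = 0"
  using pi_map_fsc[of n X 0 0] by simp

lemma pi_map_diff: "pi_map n X (u - v) = pi_map n X u - pi_map n X v"
  using pi_map_add[of n X "u - v" v] by (simp add: algebra_simps)

lemma pi_map_basis:
  assumes "finite X" "xs \<in> lists_on X (Suc n)"
  shows "pi_map (Suc n) X (tensorl (map ev xs)) = (diff_tensor xs :: nat list \<Rightarrow> 'k::field)"
proof -
  have "fsc (tensorl (map ev xs) ys) (diff_tensor ys)
      = (if ys = xs then diff_tensor xs else (0 :: nat list \<Rightarrow> 'k))" for ys
    by (simp add: tensorl_map_ev)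
  then show ?thesis using assms by (simp add: pi_map_Suc sum.delta)
qed

lemma diff_tensor_Pbar_tens:
  assumes "finite X" "xs \<in> lists_on X (Suc n)"
  shows "diff_tensor xs \<in> Pbar_tens n X"
proof -
  obtain x ys where "xs = x # ys" "x \<in> X" "set ys \<subseteq> X" "length ys = n"
    using assms(2) by (auto simp: lists_on_def length_Suc_conv)
  then show ?thesis
    using assms(1) tensorl_Pbar_tens[of X "map (\<lambda>y. ev y - ev x) ys"] ev_diff_Pbar by fastforce
qed

lemma pi_map_Pbar_tens:
  assumes "finite X"
  shows "pi_map (Suc n) X v \<in> Pbar_tens n X"
  unfolding pi_map_Suc
  by (intro fsc.subspace_sum[OF subspace_Pbar_tens] fsc.subspace_scale[OF subspace_Pbar_tens])
    (rule diff_tensor_Pbar_tens[OF assms])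

lemma push_diff_tensor:
  assumes "finite X" "xs \<in> lists_on X (Suc n)"
  shows "push X f (diff_tensor xs) = diff_tensor (map f xs)"
proof -
  obtain x ys where "xs = x # ys" "x \<in> X" "set ys \<subseteq> X"
    using assms(2) by (auto simp: lists_on_def length_Suc_conv)
  then show ?thesis
    using assms(1) by (auto simp: push_tensorl push_diff push_ev subset_iff
        intro!: arg_cong[of _ _ tensorl])
qed

text \<open>Naturality holds on representatives, not just modulo relations, since the first entry of
  a list is sent to the first entry of its image. By linearity basis tensors suffice.\<close>

lemma push_pi_map:
  fixes v :: "nat list \<Rightarrow> 'k::field"
  assumes "FA_hom X Y f" "v \<in> Ptens (Suc n) X"
  shows "push X f (pi_map (Suc n) X v) = pi_map (Suc n) Y (push X f v)"
proof -
  have fin: "finite X" "finite Y" and f: "f \<in> X \<rightarrow> Y"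
    using assms(1) by (auto simp: FA_hom_def)
  have pi_sum: "pi_map (Suc n) Y (\<Sum>i\<in>I. g i) = (\<Sum>i\<in>I. pi_map (Suc n) Y (g i))"
    for I :: "nat list set" and g
    unfolding pi_map_Suc sum_fun_apply fsc.scale_sum_left
    by (rule ext) (rule sum.swap)
  let ?L = "lists_on X (Suc n)"
  have "push X f (pi_map (Suc n) X v) = (\<Sum>xs\<in>?L. fsc (v xs) (diff_tensor (map f xs)))"
    by (simp add: pi_map_Suc push_sum push_fsc push_diff_tensor[OF fin(1)])
  also have "\<dots> = (\<Sum>xs\<in>?L. fsc (v xs) (pi_map (Suc n) Y (push X f (tensorl (map ev xs)))))"
  proof (intro sum.cong refl arg_cong[of _ _ "fsc _"])
    fix xs assume xs: "xs \<in> ?L"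
    have "push X f (tensorl (map ev xs)) = (tensorl (map ev (map f xs)) :: nat list \<Rightarrow> 'k)"
      unfolding push_tensorl map_map
      by (intro arg_cong[of _ _ tensorl] map_cong) (use xs fin push_ev in \<open>auto simp: lists_on_def\<close>)
    then show "(diff_tensor (map f xs) :: nat list \<Rightarrow> 'k)
        = pi_map (Suc n) Y (push X f (tensorl (map ev xs)))"
      by (simp only: pi_map_basis[OF fin(2) map_in_lists_on[OF f xs]])
  qed
  also have "\<dots> = pi_map (Suc n) Y (push X f (\<Sum>xs\<in>?L. fsc (v xs) (tensorl (map ev xs))))"
    by (simp only: push_sum push_fsc pi_sum pi_map_fsc)
  finally show ?thesis by (simp only: Ptens_expand[OF fin(1) assms(2), symmetric])
qed

text \<open>Distributivity: substituting the vector \<open>g x\<close> for every point x can be done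
  factor by factor.\<close>

lemma sum_tensorl_map:
  "(\<Sum>xs\<in>lists_on X (length us). fsc (tensorl us xs) (tensorl (map g xs)))
    = tensorl (map (\<lambda>u. \<Sum>x\<in>X. fsc (u [x]) (g x)) us)"
proof
  fix zs
  have "(\<Sum>xs\<in>lists_on X (length us). tensorl us xs * tensorl (map g xs) zs)
    = tensorl (map (\<lambda>u. \<Sum>x\<in>X. fsc (u [x]) (g x)) us) zs"
  proof (induction us arbitrary: zs)
    case Nil
    then show ?case by (simp add: tensorl_Nil)
  next
    case (Cons u us)
    show ?case
    proof (cases zs)
      case Nil
      then show ?thesis by (simp add: tensorl_length sum_lists_on_Suc)
    next
      case zs: (Cons z zs')
      have "(\<Sum>xs\<in>lists_on X (length (u # us)). tensorl (u # us) xs * tensorl (map g xs) zs)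
         = (\<Sum>x\<in>X. u [x] * g x [z]) * (\<Sum>xs\<in>lists_on X (length us). tensorl us xs * tensorl (map g xs) zs')"
        by (simp add: zs sum_lists_on_Suc tensorl_Cons sum_product mult_ac)
      then show ?thesis
        by (simp add: Cons.IH zs tensorl_Cons sum_fun_apply fsc_apply)
    qed
  qed
  then show "(\<Sum>xs\<in>lists_on X (length us). fsc (tensorl us xs) (tensorl (map g xs))) zs
    = tensorl (map (\<lambda>u. \<Sum>x\<in>X. fsc (u [x]) (g x)) us) zs"
    by (simp add: sum_fun_apply fsc_apply)
qed

text \<open>The coefficients sum to zero, so the base point \<open>z\<close> cancels.\<close>

lemma Pbar_eq_sum_diff:
  fixes u :: "nat list \<Rightarrow> 'k::field"
  assumes "finite X" "u \<in> Pbar X"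
  shows "(\<Sum>x\<in>X. fsc (u [x]) (ev x - ev z)) = u"
proof
  fix ys
  have "(\<Sum>x\<in>X. u [x] * ev x ys) = u ys"
  proof -
    have "u ys = (\<Sum>xs\<in>lists_on X 1. fsc (u xs) (tensorl (map ev xs))) ys"
      using Ptens_expand[OF assms(1) Pbar_Ptens[OF assms(2)]] by metis
    moreover have "tensorl [ev x] ys = (ev x ys :: 'k)" for x
      using tensorl_map_ev[of "[x]" ys] by (simp add: ev_def)
    ultimately show ?thesis by (simp add: sum_fun_apply fsc_apply sum_lists_on_1)
  qed
  moreover have "(\<Sum>x\<in>X. u [x] * ev z ys) = 0"
    using assms(2) by (simp add: Pbar_def sum_distrib_right[symmetric])
  ultimately show "(\<Sum>x\<in>X. fsc (u [x]) (ev x - ev z)) ys = u ys"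
    by (simp add: sum_fun_apply fsc_apply right_diff_distrib sum_subtractf)
qed

text \<open>Factors in P-bar do not see the base point, so the first factor enters only through its
  augmentation.\<close>

lemma pi_map_tensorl_Cons:
  assumes "finite X" "set us \<subseteq> Pbar X" "length us = n"
  shows "pi_map (Suc n) X (tensorl (u # us)) = fsc (\<Sum>x\<in>X. u [x]) (tensorl us)"
proof -
  have us: "map (\<lambda>w. \<Sum>y\<in>X. fsc (w [y]) (ev y - ev x)) us = us" for x
    using assms by (intro map_idI) (auto simp: Pbar_eq_sum_diff)
  have "pi_map (Suc n) X (tensorl (u # us))
      = (\<Sum>x\<in>X. fsc (u [x]) (\<Sum>xs\<in>lists_on X n.
          fsc (tensorl us xs) (tensorl (map (\<lambda>y. ev y - ev x) xs))))"
    by (simp add: pi_map_Suc sum_lists_on_Suc tensorl_Cons fsc.scale_sum_right)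
  also have "\<dots> = (\<Sum>x\<in>X. fsc (u [x]) (tensorl us))"
    using sum_tensorl_map[where us = us and X = X] us assms(3) by simp
  finally show ?thesis by (simp add: fsc.scale_sum_left)
qed

lemma pi_map_Pbar_tens_eq_0:
  assumes "finite X" "v \<in> Pbar_tens (Suc n) X"
  shows "pi_map (Suc n) X v = 0"
  using assms(2)
proof (induction rule: Pbar_tens_induct)
  case zero
  then show ?case by (rule pi_map_0)
next
  case (step c us v)
  then obtain w ws where "us = w # ws" "w \<in> Pbar X" "set ws \<subseteq> Pbar X" "length ws = n"
    by (cases us) auto
  then have "pi_map (Suc n) X (tensorl us) = 0"
    using pi_map_tensorl_Cons[OF assms(1), of ws n w] by (simp add: Pbar_def)
  then show "pi_map (Suc n) X (fsc c (tensorl us) + v) = 0"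
    using step by (simp add: pi_map_add pi_map_fsc fun_eq_iff fsc_apply)
qed

text \<open>Prefixing any point of \<open>X\<close>, whose augmentation is 1, gives a preimage of a
  decomposable tensor.\<close>

lemma pi_map_surj:
  fixes w :: "nat list \<Rightarrow> 'k::field"
  assumes "finite X" "w \<in> Pbar_tens n X"
  shows "\<exists>v\<in>Ptens (Suc n) X. pi_map (Suc n) X v = w"
  using assms(2)
proof (induction rule: Pbar_tens_induct)
  case zero
  then show ?case using pi_map_0 fsc.subspace_0[OF subspace_Ptens] by blast
next
  case (step c us w)
  then obtain v where v: "v \<in> Ptens (Suc n) X" "pi_map (Suc n) X v = w" by blast
  obtain x where x: "x \<in> X" using step by auto
  have us: "set us \<subseteq> Ptens 1 X"
    using step(2) Pbar_Ptens by blast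
  have "(\<Sum>z\<in>X. ev x [z]) = (1::'k)"
    using assms(1) x by (simp add: ev_def sum.delta)
  then have "pi_map (Suc n) X (tensorl (ev x # us)) = tensorl us"
    using pi_map_tensorl_Cons[OF assms(1) step(2,1), of "ev x"] by simp
  then have "pi_map (Suc n) X (fsc c (tensorl (ev x # us)) + v) = fsc c (tensorl us) + w"
    using v by (simp add: pi_map_add pi_map_fsc)
  moreover have "tensorl (ev x # us) \<in> Ptens (Suc n) X"
    using tensorl_Ptens[of "ev x # us" X] step(1) us ev_Ptens[OF x] by simp
  then have "fsc c (tensorl (ev x # us)) + v \<in> Ptens (Suc n) X"
    using v by (intro fsc.subspace_add[OF subspace_Ptens] fsc.subspace_scale[OF subspace_Ptens])
  ultimately show ?case by blast
qed

text \<open>Exchanging two later entries exchanges two factors. Exchanging the first entry with a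
  later one changes the base point, which column operations undo up to a sign.\<close>

lemma alternating_diff_tensor:
  fixes \<psi> :: "nat list \<Rightarrow> 'k::field_char_0"
  assumes "alternating \<psi>"
  shows "alternating (\<lambda>xs. pairing X (length xs - 1) \<psi> (diff_tensor xs))"
proof -
  let ?\<Psi> = "\<lambda>xs. pairing X (length xs - 1) \<psi> (diff_tensor xs)"
  have *: "?\<Psi> (permute_list (transpose i j) xs) = - ?\<Psi> xs" if ij: "i < j" "j < length xs" for i j xs
  proof -
    obtain x ys where xs: "xs = x # ys" using ij by (cases xs) auto
    obtain j' where j: "j = Suc j'" "j' < length ys" using ij xs by (cases j) auto
    show ?thesis
    proof (cases i)
      case 0
      define as bs y where "as = take j' ys" and "bs = drop (Suc j') ys" and "y = ys ! j'"
      have ys: "ys = as @ y # bs" and las: "length as = j'"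
        using j by (auto simp: as_def bs_def y_def id_take_nth_drop)
      have perm: "permute_list (transpose i j) xs = y # as @ x # bs"
        using 0 j xs ys las permute_list_transpose_0[of as x y bs] by simp
      \<comment> \<open>\<open>?d\<close> is the factor that the entry \<open>x\<close> produces for
        the base point \<open>y\<close>; adding it turns differences to \<open>x\<close> into
        differences to \<open>y\<close>.\<close>
      let ?n = "length as + length bs + 1" and ?d = "ev x - ev y :: nat list \<Rightarrow> 'k"
      let ?D = "\<lambda>z. map (\<lambda>y. ev y - ev z :: nat list \<Rightarrow> 'k)"
      have D: "?D y zs = map (\<lambda>u. u + ?d) (?D x zs)" for zs
        by (simp del: plus_fun_apply)
      have "?\<Psi> (permute_list (transpose i j) xs)
          = pairing X ?n \<psi> (tensorl ([] @ map (\<lambda>u. u + ?d) (?D x as) @ ?d # map (\<lambda>u. u + ?d) (?D x bs)))"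
        unfolding perm D[symmetric] by simp
      also have "\<dots> = pairing X ?n \<psi> (tensorl ([] @ ?D x as @ ?d # map (\<lambda>u. u + ?d) (?D x bs)))"
        by (rule pairing_tensorl_shift[OF assms]) auto
      \<comment> \<open>Regrouped so that \<open>?d\<close> belongs to the prefix for the second
        shift.\<close>
      also have "\<dots> = pairing X ?n \<psi> (tensorl ((?D x as @ [?d]) @ map (\<lambda>u. u + ?d) (?D x bs) @ []))"
        by (simp only: append_Nil append_Nil2 append_assoc append_Cons)
      also have "\<dots> = pairing X ?n \<psi> (tensorl ((?D x as @ [?d]) @ ?D x bs @ []))"
        by (rule pairing_tensorl_shift[OF assms]) auto
      \<comment> \<open>The sign arises here: \<open>?d\<close> is the negative of the factor of
        \<open>y\<close> for the base point \<open>x\<close>.\<close>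
      also have "\<dots> = pairing X ?n \<psi> (tensorl (?D x as @ (- (ev y - ev x)) # ?D x bs))"
        by simp
      also have "\<dots> = - ?\<Psi> xs"
        unfolding tensorl_uminus pairing_minus by (simp add: xs ys)
      finally show ?thesis .
    next
      case (Suc i')
      then have i: "i' < length ys" "i' \<noteq> j'" using ij j by auto
      have "permute_list (transpose i j) xs = x # permute_list (transpose i' j') ys"
        using permute_list_transpose_Suc[of i' ys j' x] i j Suc xs by simp
      then show ?thesis
        using pairing_tensorl_transpose[OF assms, of i' "map (\<lambda>y. ev y - ev x) ys" j' X] i j
        by (simp add: xs permute_list_map transpose_permutes_lessThan)
    qed
  qed
  show ?thesis
    unfolding alternating_def
  proof (intro allI impI)
    fix xs :: "nat list" and i j
    assume "i < length xs" "j < length xs" "i \<noteq> j"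
    then show "?\<Psi> (permute_list (transpose i j) xs) = - ?\<Psi> xs"
      using *[of i j xs] *[of j i xs] by (cases i j rule: linorder_cases) (auto simp: transpose_commute)
  qed
qed

text \<open>Writing \<open>length xs - 1\<close> for \<open>n\<close> makes the transposed function
  independent of the degree, as \<open>alternating\<close> speaks of lists of every length.\<close>

lemma pairing_pi_map:
  "pairing X n \<psi> (pi_map (Suc n) X v)
    = pairing X (Suc n) (\<lambda>xs. pairing X (length xs - 1) \<psi> (diff_tensor xs)) v"
  unfolding pi_map_Suc pairing_sum pairing_fsc
  by (subst (2) pairing_def) (auto simp: lists_on_def intro!: sum.cong)

text \<open>The homotopy identity as seen by \<psi>. Column operations subtract x, the head of
  \<open>xs\<close>, from the later factors; the first factor splits as (x - z) + z; in the first
  summand, adding x - z to the later factors makes all differences relative to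
  \<open>z\<close>.\<close>

lemma pairing_diff_decomp:
  fixes \<psi> :: "nat list \<Rightarrow> 'k::field_char_0"
  assumes "alternating \<psi>" "finite X" "z \<in> X" "xs \<in> lists_on X (Suc n)"
  shows "\<psi> xs = pairing X (Suc n) \<psi> (tensorl (map (\<lambda>y. ev y - ev z) xs))
    + pairing X n (\<lambda>ys. \<psi> (z # ys)) (diff_tensor xs)"
proof -
  obtain x ys where xs: "xs = x # ys" "x \<in> X" "set ys \<subseteq> X" "length ys = n"
    using assms(4) by (auto simp: lists_on_def length_Suc_conv)
  let ?D = "\<lambda>z. map (\<lambda>y. ev y - ev z :: nat list \<Rightarrow> 'k)"
  let ?\<Psi> = "\<lambda>us. pairing X (Suc n) \<psi> (tensorl us)"
  have shift: "?\<Psi> (d # map (\<lambda>u. u + d) us) = ?\<Psi> (d # us)" if "length us = n" for d us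
    using pairing_tensorl_shift[OF assms(1), of d "[d]" "[]" "Suc n" us X] that
    by (simp del: plus_fun_apply)
  have "map ev ys = map (\<lambda>u. u + ev x) (?D x ys)"
    by (simp del: plus_fun_apply)
  then have "\<psi> xs = ?\<Psi> (ev x # ?D x ys)"
    using pairing_tensorl_ev[OF assms(2,4), of \<psi>] shift[of "?D x ys" "ev x"] xs by (simp only: list.map length_map)
  also have "\<dots> = ?\<Psi> ([] @ ((ev x - ev z) + ev z) # ?D x ys)"
    by (simp del: plus_fun_apply)
  also have "\<dots> = ?\<Psi> ((ev x - ev z) # ?D x ys) + ?\<Psi> (ev z # ?D x ys)"
    unfolding tensorl_add pairing_add by (simp only: append_Nil)
  also have "?\<Psi> ((ev x - ev z) # ?D x ys) = ?\<Psi> ((ev x - ev z) # map (\<lambda>u. u + (ev x - ev z)) (?D x ys))"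
    by (rule shift[symmetric]) (simp add: xs)
  also have "(ev x - ev z) # map (\<lambda>u. u + (ev x - ev z)) (?D x ys) = ?D z xs"
    by (simp add: xs del: plus_fun_apply)
  also have "?\<Psi> (ev z # ?D x ys) = pairing X n (\<lambda>ys. \<psi> (z # ys)) (diff_tensor xs)"
    using pairing_tensorl_ev_Cons[OF assms(2,3)] xs by simp
  finally show ?thesis .
qed

section \<open>Exactness\<close>

interpretation P: tensor_subfunctor n "Ptens n :: nat set \<Rightarrow> (nat list \<Rightarrow> 'k::field_char_0) set" for n
  by (rule tensor_subfunctor_Ptens)

interpretation Pbar: tensor_subfunctor n "Pbar_tens n :: nat set \<Rightarrow> (nat list \<Rightarrow> 'k::field_char_0) set" for n
  by (rule tensor_subfunctor_Pbar_tens)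

lemma is_famod_LamP: "is_famod fsc (LamP t :: (nat list \<Rightarrow> 'k::field_char_0) famod)"
  unfolding LamP_def by (rule P.is_famod)

lemma is_famod_LamPbar: "is_famod fsc (LamPbar t :: (nat list \<Rightarrow> 'k::field_char_0) famod)"
  unfolding LamPbar_def by (rule Pbar.is_famod)

lemma is_famod_kzero: "is_famod fsc (kzero :: (nat list \<Rightarrow> 'k::field) famod)"
  unfolding is_famod_def kzero_def famod.simps
  by (intro conjI vector_space_fsc)
    (auto simp: subspace_Ptens fsc.subspace_0 fsc.subspace_single_0 lin_on_def FA_hom_def fun_eq_iff)

lemma is_famod_LamPbar_pred: "is_famod fsc (LamPbar_pred t :: (nat list \<Rightarrow> 'k::field_char_0) famod)"
  by (simp add: LamPbar_pred_def is_famod_LamPbar is_famod_kzero)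

lemma zero_in_sgn_rel [simp]: "0 \<in> sgn_rel n V"
  unfolding sgn_rel_def by (rule fsc.span_zero)

text \<open>Only the identity permutes the empty set, so all relations in degree 0 are
  trivial.\<close>

lemma sgn_rel_0: "sgn_rel 0 V = {0}"
proof -
  have "{v - fsc (of_int (sign \<sigma>)) (permact \<sigma> v) | v \<sigma>. v \<in> V \<and> \<sigma> permutes {..<0}} \<subseteq> {0}"
    by (auto simp: permact_eq id_def[symmetric])
  then have "sgn_rel 0 V \<subseteq> {0}"
    unfolding sgn_rel_def by (rule fsc.span_minimal) (rule fsc.subspace_single_0)
  then show ?thesis using zero_in_sgn_rel by blast
qed

lemma push_Ptens_0:
  assumes "v \<in> Ptens 0 X"
  shows "push X f v = v"
proof
  fix ys
  have "v xs = 0" if "xs \<noteq> []" for xs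
    using that PtensD[OF assms] by simp
  then show "push X f v ys = v ys"
    by (cases ys) (auto simp: push_def lists_on_Suc intro!: sum.neutral)
qed

text \<open>The transposed contraction turns alternating test functions on the target into
  alternating ones on the source.\<close>

lemma pi_map_sgn_rel:
  fixes v :: "nat list \<Rightarrow> 'k::field_char_0"
  assumes "finite X" "v \<in> sgn_rel (Suc n) (Ptens (Suc n) X)"
  shows "pi_map (Suc n) X v \<in> sgn_rel n (Pbar_tens n X)"
  unfolding Pbar.mem_sgn_rel_iff[OF assms(1)] pairing_pi_map
  by (intro conjI allI impI pi_map_Pbar_tens[OF assms(1)]
      pairing_sgn_rel[OF alternating_diff_tensor assms(2)])

lemma is_mor_iota: "is_mor fsc fsc (LamPbar t) (LamP t :: (nat list \<Rightarrow> 'k::field_char_0) famod) iota_map"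
proof -
  have "v \<in> Ptens t X" if "finite X" "v \<in> Pbar_tens t X" for X and v :: "nat list \<Rightarrow> 'k"
    using that Pbar.V_Ptens by blast
  then show ?thesis
    by (auto simp: is_mor_def LamP_def LamPbar_def iota_map_def lin_on_def P.mem_sgn_rel_iff
        Pbar.mem_sgn_rel_iff FA_hom_def)
qed

lemma is_mono_iota: "is_mono (LamPbar t) (LamP t :: (nat list \<Rightarrow> 'k::field_char_0) famod) iota_map"
  by (simp add: is_mono_def LamP_def LamPbar_def iota_map_def P.mem_sgn_rel_iff
      Pbar.mem_sgn_rel_iff)

lemma is_mor_pi: "is_mor fsc fsc (LamP t) (LamPbar_pred t :: (nat list \<Rightarrow> 'k::field_char_0) famod) (pi_map t)"
proof (cases t)
  case 0
  then show ?thesis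
    by (auto simp: is_mor_def LamP_def LamPbar_pred_def kzero_def lin_on_def pi_map_def sgn_rel_0
        FA_hom_def push_Ptens_0)
next
  case (Suc n)
  have "pi_map (Suc n) Y (push X f v) - push X f (pi_map (Suc n) X v) \<in> sgn_rel n (Pbar_tens n Y)"
    if "FA_hom X Y f" "v \<in> Ptens (Suc n) X" for X Y f and v :: "nat list \<Rightarrow> 'k"
    using push_pi_map[OF that] zero_in_sgn_rel by simp
  then show ?thesis
    by (auto simp: is_mor_def LamP_def LamPbar_def LamPbar_pred_def Suc lin_on_def pi_map_add
        pi_map_fsc pi_map_Pbar_tens pi_map_sgn_rel)
qed

lemma is_epi_pi: "is_epi (LamP t) (LamPbar_pred t :: (nat list \<Rightarrow> 'k::field_char_0) famod) (pi_map t)"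
proof (cases t)
  case 0
  have "(0 :: nat list \<Rightarrow> 'k) \<in> Ptens 0 X" for X
    by (rule fsc.subspace_0[OF subspace_Ptens])
  then show ?thesis
    using 0 by (auto simp: is_epi_def LamP_def LamPbar_pred_def kzero_def pi_map_def)
next
  case (Suc n)
  have "\<exists>v\<in>Ptens (Suc n) X. pi_map (Suc n) X v - w \<in> sgn_rel n (Pbar_tens n X)"
    if "finite X" "w \<in> Pbar_tens n X" for X and w :: "nat list \<Rightarrow> 'k"
    using pi_map_surj[OF that] zero_in_sgn_rel[of n] by (metis diff_self)
  then show ?thesis
    by (simp add: is_epi_def LamP_def LamPbar_def LamPbar_pred_def Suc)
qed

lemma pi_exact:
  fixes w :: "nat list \<Rightarrow> 'k::field_char_0"
  assumes "finite X" "w \<in> Ptens (Suc n) X" "pi_map (Suc n) X w \<in> sgn_rel n (Pbar_tens n X)"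
  shows "\<exists>v\<in>Pbar_tens (Suc n) X. v - w \<in> sgn_rel (Suc n) (Ptens (Suc n) X)"
proof (cases "X = {}")
  \<comment> \<open>No base point exists here, but there are no lists of positive length either, so
    both tensor powers vanish.\<close>
  case True
  then show ?thesis using assms zero_in_sgn_rel by (auto simp: Ptens_empty Pbar_tens_eq)
next
  case False
  then obtain z where z: "z \<in> X" by blast
  let ?D = "\<lambda>xs. tensorl (map (\<lambda>y. ev y - ev z :: nat list \<Rightarrow> 'k) xs)"
  \<comment> \<open>The first term of the homotopy: subtracting \<open>z\<close> from every point
    puts each factor into P-bar.\<close>
  define v where "v = (\<Sum>xs\<in>lists_on X (Suc n). fsc (w xs) (?D xs))"
  have "?D xs \<in> Pbar_tens (Suc n) X" if "xs \<in> lists_on X (Suc n)" for xs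
  proof -
    have "set (map (\<lambda>y. ev y - ev z :: nat list \<Rightarrow> 'k) xs) \<subseteq> Pbar X"
      using that ev_diff_Pbar[OF assms(1) z] by (auto simp: lists_on_def)
    then show ?thesis
      using tensorl_Pbar_tens[OF False] that by (fastforce simp: lists_on_def)
  qed
  then have v: "v \<in> Pbar_tens (Suc n) X"
    unfolding v_def
    by (intro fsc.subspace_sum[OF subspace_Pbar_tens] fsc.subspace_scale[OF subspace_Pbar_tens])
  have "pairing X (Suc n) \<psi> (v - w) = 0" if \<psi>: "alternating \<psi>" for \<psi>
  proof -
    let ?E = "\<lambda>xs. pairing X n (\<lambda>ys. \<psi> (z # ys)) (diff_tensor xs)"
    have "pairing X (Suc n) \<psi> w = (\<Sum>xs\<in>lists_on X (Suc n).
        w xs * (pairing X (Suc n) \<psi> (?D xs) + ?E xs))"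
      unfolding pairing_def[of X "Suc n" \<psi> w]
      by (intro sum.cong refl) (use pairing_diff_decomp[OF \<psi> assms(1) z] in simp)
    also have "\<dots> = pairing X (Suc n) \<psi> v + pairing X n (\<lambda>ys. \<psi> (z # ys)) (pi_map (Suc n) X w)"
      unfolding v_def pi_map_Suc pairing_sum pairing_fsc
      by (simp add: distrib_left sum.distrib)
    \<comment> \<open>Prefixing \<open>z\<close> to the argument of \<psi> leaves it alternating, so
      it kills the contraction of \<open>w\<close>, a relation by assumption.\<close>
    also have "pairing X n (\<lambda>ys. \<psi> (z # ys)) (pi_map (Suc n) X w) = 0"
      using pairing_sgn_rel[OF alternating_Cons[OF \<psi>] assms(3)] .
    finally show ?thesis by (simp add: pairing_diff)
  qed
  moreover have "v - w \<in> Ptens (Suc n) X"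
    using fsc.subspace_diff[OF subspace_Ptens] v assms Pbar.V_Ptens by blast
  ultimately show ?thesis
    using v by (auto simp: P.mem_sgn_rel_iff assms(1))
qed

lemma is_ses_LamP:
  "is_ses fsc fsc fsc (LamPbar t) (LamP t :: (nat list \<Rightarrow> 'k::field_char_0) famod)
     (LamPbar_pred t) iota_map (pi_map t)"
proof -
  have 1: "pi_map t X (iota_map X v) \<in> Nu (LamPbar_pred t) X"
    if "finite X" "v \<in> Mo (LamPbar t) X" for X and v :: "nat list \<Rightarrow> 'k"
  proof (cases t)
    case 0
    then show ?thesis
      using that by (auto simp: LamPbar_def LamPbar_pred_def kzero_def pi_map_def iota_map_def Pbar_tens_def)
  next
    case (Suc n)
    then have "pi_map t X v = 0"
      using that pi_map_Pbar_tens_eq_0[of X v n] by (simp add: LamPbar_def)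
    then show ?thesis
      using Suc zero_in_sgn_rel by (simp add: LamPbar_def LamPbar_pred_def iota_map_def)
  qed
  have 2: "\<exists>v\<in>Mo (LamPbar t) X. iota_map X v - w \<in> Nu (LamP t) X"
    if "finite X" "w \<in> Mo (LamP t) X" "pi_map t X w \<in> Nu (LamPbar_pred t) X"
    for X and w :: "nat list \<Rightarrow> 'k"
  proof (cases t)
    case 0
    then have "w \<in> Pbar_tens 0 X"
      using that by (auto simp: LamP_def LamPbar_pred_def kzero_def pi_map_def Pbar_tens_def split: if_splits)
    then show ?thesis
      using 0 zero_in_sgn_rel by (auto simp: LamP_def LamPbar_def iota_map_def intro!: bexI[of _ w])
  next
    case (Suc n)
    then show ?thesis
      using that pi_exact[of X w n] by (simp add: LamP_def LamPbar_def LamPbar_pred_def iota_map_def)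
  qed
  show ?thesis
    unfolding is_ses_def
    using is_famod_LamP is_famod_LamPbar is_famod_LamPbar_pred is_mor_iota is_mono_iota is_mor_pi
      is_epi_pi 1 2 by blast
qed

section \<open>The generator\<close>

abbreviation generator :: "nat \<Rightarrow> nat list \<Rightarrow> 'k::field" where
  "generator t \<equiv> tensorl (map ev [0..<t])"

text \<open>A list over X of length t read as a map from \<open>{..<t}\<close> to X, which
  identifies basis tensors with the basis of the standard projective.\<close>

definition list_fun :: "nat list \<Rightarrow> nat \<Rightarrow> nat" where
  "list_fun xs = restrict (nth xs) {..<length xs}"

lemma upt_lists_on: "[0..<t] \<in> lists_on {..<t} t"
  by (auto simp: lists_on_def)

lemma generator_Ptens: "generator t \<in> Ptens t {..<t}"
  by (rule basis_Ptens[OF upt_lists_on])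

lemma FA_hom_list_fun: "finite X \<Longrightarrow> xs \<in> lists_on X t \<Longrightarrow> FA_hom {..<t} X (list_fun xs)"
  by (auto simp: FA_hom_def list_fun_def lists_on_def)

lemma map_list_fun: "map (list_fun xs) [0..<length xs] = xs"
  by (intro nth_equalityI) (auto simp: list_fun_def)

lemma compose_list_fun: "compose {..<length xs} f (list_fun xs) = list_fun (map f xs)"
  by (auto simp: compose_def list_fun_def fun_eq_iff)

lemma push_generator:
  assumes "xs \<in> lists_on X t"
  shows "push {..<t} (list_fun xs) (generator t) = (tensorl (map ev xs) :: nat list \<Rightarrow> 'k::field)"
proof -
  have "push {..<t} (list_fun xs) (generator t)
      = (tensorl (map ev (map (list_fun xs) [0..<t])) :: nat list \<Rightarrow> 'k)"
    unfolding push_tensorl map_map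
    by (intro arg_cong[of _ _ tensorl] map_cong) (auto simp: push_ev)
  then show ?thesis using assms map_list_fun[of xs] by (simp add: lists_on_def del: map_map)
qed

text \<open>A list with a repetition gives 0 on both sides. Otherwise counting makes it a
  rearrangement of \<open>[0..<t]\<close>, and both sides pick up the same sign.\<close>

lemma alternating_lists_on_lessThan:
  fixes \<psi> :: "nat list \<Rightarrow> 'k::field_char_0"
  assumes "alternating \<psi>" "xs \<in> lists_on {..<t} t"
  shows "\<psi> xs = \<psi> [0..<t] * alt_delta [0..<t] xs"
proof (cases "distinct xs")
  case True
  have "set xs \<subseteq> {..<t}" "card (set xs) = t"
    using assms(2) True by (auto simp: lists_on_def distinct_card)
  then have "set xs = {..<t}" by (intro card_subset_eq) auto
  then have "mset xs = mset [0..<t]"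
    using True by (intro set_eq_iff_mset_eq_distinct[THEN iffD1]) (auto simp: atLeast0LessThan)
  then obtain \<sigma> where \<sigma>: "\<sigma> permutes {..<length [0..<t]}" "permute_list \<sigma> [0..<t] = xs"
    by (rule mset_eq_permutation)
  have "alt_delta [0..<t] xs = (of_int (sign \<sigma>) :: 'k)"
    using alternating_permute[OF alternating_alt_delta \<sigma>(1), of "[0..<t]"] \<sigma>(2)
    by (simp add: alt_delta_self)
  then show ?thesis
    using alternating_permute[OF assms(1) \<sigma>(1)] \<sigma>(2) by (simp add: mult.commute)
next
  case False
  have "alt_delta [0..<t] xs = (0::'k)"
    by (rule alternating_eq_0[OF alternating_alt_delta False])
  then show ?thesis
    using alternating_eq_0[OF assms(1) False] by simp
qed

lemma top_exterior_power_dim_1: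
  fixes v :: "nat list \<Rightarrow> 'k::field_char_0"
  assumes "v \<in> Ptens t {..<t}"
  shows "\<exists>c. v - fsc c (generator t) \<in> sgn_rel t (Ptens t {..<t})"
proof -
  \<comment> \<open>The determinant of \<open>v\<close>: all alternating functions on these lists
    are multiples of this single one.\<close>
  define c where "c = pairing {..<t} t (alt_delta [0..<t]) v"
  have "pairing {..<t} t \<psi> (v - fsc c (generator t)) = 0" if \<psi>: "alternating \<psi>" for \<psi>
  proof -
    have "pairing {..<t} t \<psi> v = \<psi> [0..<t] * c"
      unfolding c_def pairing_def sum_distrib_left
      by (intro sum.cong refl) (simp add: alternating_lists_on_lessThan[OF \<psi>] mult_ac)
    then show ?thesis
      by (simp add: pairing_diff pairing_fsc pairing_tensorl_ev[OF _ upt_lists_on])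
  qed
  moreover have "v - fsc c (generator t) \<in> Ptens t {..<t}"
    using assms generator_Ptens
    by (intro fsc.subspace_diff[OF subspace_Ptens] fsc.subspace_scale[OF subspace_Ptens])
  ultimately show ?thesis by (auto simp: P.mem_sgn_rel_iff)
qed

lemma generator_notin_sgn_rel:
  "(generator t :: nat list \<Rightarrow> 'k::field_char_0) \<notin> sgn_rel t (Ptens t {..<t})"
proof
  assume "(generator t :: nat list \<Rightarrow> 'k) \<in> sgn_rel t (Ptens t {..<t})"
  then have "pairing {..<t} t (alt_delta [0..<t]) (generator t) = (0::'k)"
    by (rule pairing_sgn_rel[OF alternating_alt_delta])
  then show False
    by (simp add: pairing_tensorl_ev[OF _ upt_lists_on] alt_delta_self)
qed

text \<open>Take the base point 0, the first entry of the list. The tensor of all differences to 0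
  has a zero factor, so the determinant of the list, which is 1, would equal the pairing of a
  relation with an alternating function.\<close>

lemma diff_generator_notin_sgn_rel:
  "(diff_tensor [0..<Suc n] :: nat list \<Rightarrow> 'k::field_char_0) \<notin> sgn_rel n (Pbar_tens n {..<Suc n})"
proof
  let ?X = "{..<Suc n}" and ?xs = "[0..<Suc n]"
  let ?\<psi> = "alt_delta ?xs :: nat list \<Rightarrow> 'k"
  assume *: "(diff_tensor ?xs :: nat list \<Rightarrow> 'k) \<in> sgn_rel n (Pbar_tens n ?X)"
  have "pairing ?X n (\<lambda>ys. ?\<psi> (0 # ys)) (diff_tensor ?xs) = 0"
    by (rule pairing_sgn_rel[OF alternating_Cons[OF alternating_alt_delta] *])
  moreover have "pairing ?X (Suc n) ?\<psi> (tensorl (map (\<lambda>y. ev y - ev 0) ?xs)) = 0"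
  proof -
    have "?xs = 0 # [1..<Suc n]" by (simp add: upt_conv_Cons del: upt_Suc)
    then show ?thesis by (simp add: pairing_tensorl_Cons del: upt_Suc)
  qed
  ultimately have "?\<psi> ?xs = 0"
    using pairing_diff_decomp[of ?\<psi> ?X 0 ?xs n, OF alternating_alt_delta] upt_lists_on[of "Suc n"]
    by (simp del: upt_Suc)
  then show False by (simp add: alt_delta_self del: upt_Suc)
qed

lemma pi_generator_notin_Nu:
  "pi_map t {..<t} (generator t :: nat list \<Rightarrow> 'k::field_char_0) \<notin> Nu (LamPbar_pred t) {..<t}"
proof (cases t)
  case 0
  have "(tensorl [] :: nat list \<Rightarrow> 'k) [] = 1" by (simp add: tensorl_Nil)
  then have "(tensorl [] :: nat list \<Rightarrow> 'k) \<noteq> 0" by (metis zero_fun_apply zero_neq_one)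
  then show ?thesis using 0 by (simp add: pi_map_def LamPbar_pred_def kzero_def)
next
  case (Suc n)
  then show ?thesis
    using pi_map_basis[OF _ upt_lists_on[of "Suc n"], where 'k = 'k] diff_generator_notin_sgn_rel[of n, where 'k = 'k]
    by (simp add: LamPbar_pred_def LamPbar_def del: upt_Suc)
qed

section \<open>Subfunctors of the exterior power of the projective\<close>

text \<open>Every basis tensor is the image of the generator under the map encoded by its
  list.\<close>

lemma LamP_subfunctor_generator:
  fixes U :: "nat set \<Rightarrow> (nat list \<Rightarrow> 'k::field_char_0) set"
  assumes "is_subfunctor fsc (LamP t) U" "generator t \<in> U {..<t}" "finite X"
  shows "U X = Ptens t X"
proof
  show "U X \<subseteq> Ptens t X"
    using assms by (simp add: is_subfunctor_def LamP_def)
  have sub: "fsc.subspace (U X)"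
    using assms by (simp add: is_subfunctor_def)
  have "tensorl (map ev xs) \<in> U X" if "xs \<in> lists_on X t" for xs
    using assms FA_hom_list_fun[OF assms(3) that] push_generator[OF that, where 'k = 'k]
    by (force simp: is_subfunctor_def LamP_def)
  then have "(\<Sum>xs\<in>lists_on X t. fsc (v xs) (tensorl (map ev xs))) \<in> U X" for v
    by (intro fsc.subspace_sum[OF sub] fsc.subspace_scale[OF sub])
  then show "Ptens t X \<subseteq> U X"
    using Ptens_expand[OF assms(3)] by (metis subsetI)
qed

lemma LamP_subfunctor_cases:
  fixes U :: "nat set \<Rightarrow> (nat list \<Rightarrow> 'k::field_char_0) set"
  assumes "is_subfunctor fsc (LamP t) U"
  shows "(\<forall>X. finite X \<longrightarrow> U X = Ptens t X) \<or> U {..<t} = sgn_rel t (Ptens t {..<t})"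
proof (cases "U {..<t} = sgn_rel t (Ptens t {..<t})")
  case False
  have sub: "fsc.subspace (U {..<t})" and U: "U {..<t} \<subseteq> Ptens t {..<t}"
    and N: "sgn_rel t (Ptens t {..<t}) \<subseteq> U {..<t}"
    using assms by (auto simp: is_subfunctor_def LamP_def)
  from False N obtain u where u: "u \<in> U {..<t}" "u \<notin> sgn_rel t (Ptens t {..<t})" by blast
  obtain c where c: "u - fsc c (generator t) \<in> sgn_rel t (Ptens t {..<t})"
    using top_exterior_power_dim_1 U u by blast
  then have "c \<noteq> 0" using u by auto
  have "u - (u - fsc c (generator t)) \<in> U {..<t}"
    by (rule fsc.subspace_diff[OF sub u(1) subsetD[OF N c]])
  then have "fsc c (generator t) \<in> U {..<t}" by simp
  then have "fsc (1 / c) (fsc c (generator t)) \<in> U {..<t}"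
    by (rule fsc.subspace_scale[OF sub])
  then have "generator t \<in> U {..<t}" using \<open>c \<noteq> 0\<close> by simp
  then show ?thesis using LamP_subfunctor_generator[OF assms] by blast
qed simp

lemma is_indecomposable_LamP:
  "is_indecomposable fsc (LamP t :: (nat list \<Rightarrow> 'k::field_char_0) famod)"
  unfolding is_indecomposable_def
proof (intro conjI allI impI)
  show "is_famod fsc (LamP t :: (nat list \<Rightarrow> 'k) famod)" by (rule is_famod_LamP)
  show "\<not> is_zero_mod (LamP t :: (nat list \<Rightarrow> 'k) famod)"
    using generator_notin_sgn_rel generator_Ptens
    by (auto simp: is_zero_mod_def LamP_def intro!: exI[of _ "{..<t}"])
next
  fix U1 U2 :: "nat set \<Rightarrow> (nat list \<Rightarrow> 'k) set"
  let ?N = "sgn_rel t (Ptens t {..<t}) :: (nat list \<Rightarrow> 'k) set"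
  assume U: "is_subfunctor fsc (LamP t) U1" "is_subfunctor fsc (LamP t) U2"
  assume dec: "\<forall>X. finite X \<longrightarrow> U1 X \<inter> U2 X = Nu (LamP t) X
    \<and> (\<forall>v\<in>Mo (LamP t) X. \<exists>a\<in>U1 X. \<exists>b\<in>U2 X. v = a + b)"
  \<comment> \<open>If both summands vanished at \<open>{..<t}\<close>, the generator would be a sum
    of two relations.\<close>
  have "\<not> (U1 {..<t} = ?N \<and> U2 {..<t} = ?N)"
  proof
    assume N: "U1 {..<t} = ?N \<and> U2 {..<t} = ?N"
    have "\<forall>v\<in>Ptens t {..<t}. \<exists>a\<in>U1 {..<t}. \<exists>b\<in>U2 {..<t}. v = a + b"
      using dec by (simp add: LamP_def)
    then obtain a b where "a \<in> U1 {..<t}" "b \<in> U2 {..<t}" "generator t = a + b"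
      using generator_Ptens by blast
    then have "generator t \<in> ?N"
      using N by (simp add: sgn_rel_def fsc.span_add)
    then show False using generator_notin_sgn_rel by blast
  qed
  then consider "\<forall>X. finite X \<longrightarrow> U1 X = Ptens t X" | "\<forall>X. finite X \<longrightarrow> U2 X = Ptens t X"
    using U LamP_subfunctor_cases by blast
  then show "(\<forall>X. finite X \<longrightarrow> U1 X = Nu (LamP t) X) \<or> (\<forall>X. finite X \<longrightarrow> U2 X = Nu (LamP t) X)"
  proof cases
    case 1
    have "U2 X = Nu (LamP t) X" if "finite X" for X
    proof -
      \<comment> \<open>A complement of the whole equals its intersection with the whole, which is
        zero.\<close>
      have "U2 X \<subseteq> U1 X" using U(2) 1 that by (simp add: is_subfunctor_def LamP_def)
      then show ?thesis using dec that by blast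
    qed
    then show ?thesis by blast
  next
    case 2
    have "U1 X = Nu (LamP t) X" if "finite X" for X
    proof -
      have "U1 X \<subseteq> U2 X" using U(1) 2 that by (simp add: is_subfunctor_def LamP_def)
      then show ?thesis using dec that by blast
    qed
    then show ?thesis by blast
  qed
qed

text \<open>If \<open>U\<close> vanished at \<open>{..<t}\<close>, the generator would be a relation
  plus an element of the kernel, so its contraction would be zero, against
  \<open>pi_generator_notin_Nu\<close>.\<close>

lemma ker_pi_superfluous:
  fixes U :: "nat set \<Rightarrow> (nat list \<Rightarrow> 'k::field_char_0) set"
  assumes "is_subfunctor fsc (LamP t) U"
    and "\<forall>X. finite X \<longrightarrow> (\<forall>v\<in>Mo (LamP t) X. \<exists>u\<in>U X. \<exists>k\<in>Mo (LamP t) X.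
      pi_map t X k \<in> Nu (LamPbar_pred t) X \<and> v = u + k)"
    and "finite X"
  shows "U X = Mo (LamP t) X"
proof -
  have "U {..<t} \<noteq> sgn_rel t (Ptens t {..<t})"
  proof
    assume N: "U {..<t} = sgn_rel t (Ptens t {..<t})"
    have "\<forall>v\<in>Ptens t {..<t}. \<exists>u\<in>U {..<t}. \<exists>k\<in>Ptens t {..<t}.
        pi_map t {..<t} k \<in> Nu (LamPbar_pred t) {..<t} \<and> v = u + k"
      using assms(2) by (simp add: LamP_def)
    then obtain u k where uk: "u \<in> U {..<t}" "pi_map t {..<t} k \<in> Nu (LamPbar_pred t) {..<t}"
      "generator t = u + k"
      using generator_Ptens by blast
    have "pi_map t {..<t} u \<in> Nu (LamPbar_pred t) {..<t}"
      using is_mor_pi[of t, where 'k = 'k] uk(1) N by (simp add: is_mor_def LamP_def)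
    moreover have "fsc.subspace (Nu (LamPbar_pred t) {..<t} :: (nat list \<Rightarrow> 'k) set)"
      using is_famod_LamPbar_pred[of t, where 'k = 'k] by (simp add: is_famod_def)
    ultimately have "pi_map t {..<t} (u + k) \<in> Nu (LamPbar_pred t) {..<t}"
      unfolding pi_map_add using uk(2) by (intro fsc.subspace_add)
    then show False using pi_generator_notin_Nu[of t] uk(3) by metis
  qed
  then show ?thesis
    using LamP_subfunctor_cases[OF assms(1)] assms(3) by (simp add: LamP_def)
qed

section \<open>Simplicity\<close>

text \<open>The hypothesis compares entries of \<open>ys\<close> with entries of \<open>xs\<close>
  only: two entries of \<open>xs\<close> outside \<open>ys\<close> may be identified by
  \<open>f\<close>. Coincidences are only ever tested between a rearrangement of \<open>ys\<close>
  and \<open>xs\<close>.\<close>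

lemma alt_delta_map:
  assumes "\<And>x y. x \<in> set ys \<Longrightarrow> y \<in> set xs \<Longrightarrow> f x = f y \<Longrightarrow> x = y"
  shows "alt_delta (map f ys) (map f xs) = alt_delta ys xs"
  unfolding alt_delta_def length_map
proof (intro sum.cong refl)
  fix \<sigma> assume "\<sigma> \<in> {\<sigma>. \<sigma> permutes {..<length ys}}"
  then have \<sigma>: "\<sigma> permutes {..<length ys}" by simp
  have "map f (permute_list \<sigma> ys) = map f xs \<longleftrightarrow> permute_list \<sigma> ys = xs"
    using list.inj_map_strong[of "permute_list \<sigma> ys" xs f f] assms \<sigma> by auto
  then show "(if permute_list \<sigma> (map f ys) = map f xs then of_int (sign \<sigma>) else 0)
      = (if permute_list \<sigma> ys = xs then of_int (sign \<sigma>) else 0)"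
    using permute_list_map[OF \<sigma>, of f] by simp
qed

text \<open>The map keeps the points of one basis list in the support of the antisymmetrized vector apart
  and collapses all others to one point.\<close>

lemma exists_push_notin_sgn_rel:
  fixes v :: "nat list \<Rightarrow> 'k::field_char_0"
  assumes "finite X" "v \<in> Pbar_tens n X" "v \<notin> sgn_rel n (Pbar_tens n X)"
  shows "\<exists>f. FA_hom X {..<Suc n} f \<and> push X f v \<notin> sgn_rel n (Pbar_tens n {..<Suc n})"
proof -
  \<comment> \<open>A failed test gives \<open>ys\<close> with no information beyond its length; a
    non-zero term of the pairing then shows it to be a rearrangement of a repetition-free list over
    \<open>X\<close>.\<close>
  obtain ys where ys: "length ys = n" "pairing X n (alt_delta ys) v \<noteq> 0"
    using sgn_relI[OF assms(2,1) Pbar.V_Ptens[OF assms(1)]] assms(3) by blast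
  then have "(\<Sum>xs\<in>lists_on X n. v xs * alt_delta ys xs) \<noteq> 0"
    by (simp add: pairing_def)
  then obtain xs where "xs \<in> lists_on X n" "v xs * alt_delta ys xs \<noteq> 0"
    by (rule sum.not_neutral_contains_not_neutral)
  then have xs: "xs \<in> lists_on X n" "alt_delta ys xs \<noteq> (0::'k)" by auto
  then have "distinct xs"
    using alternating_eq_0[OF alternating_alt_delta] by blast
  moreover obtain \<sigma> where "\<sigma> permutes {..<length ys}" "permute_list \<sigma> ys = xs"
    using xs(2) unfolding alt_delta_def
    by (rule sum.not_neutral_contains_not_neutral) (auto split: if_splits)
  ultimately have dist: "distinct ys" and sub: "set ys \<subseteq> X"
    using xs(1) by (auto simp: lists_on_def)
  have "card (set ys) = n" using dist ys(1) by (simp add: distinct_card)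
  then obtain h where h: "bij_betw h (set ys) {0..<n}"
    using ex_bij_betw_finite_nat[of "set ys"] by auto
  \<comment> \<open>\<open>Suc\<close> reserves 0 for the collapsed points, whence the one extra
    element of the target.\<close>
  define f where "f = restrict (\<lambda>x. if x \<in> set ys then Suc (h x) else 0) X"
  have f: "FA_hom X {..<Suc n} f"
    using assms(1) bij_betwE[OF h] by (auto simp: FA_hom_def f_def)
  have inj: "x = y" if "x \<in> set ys" "y \<in> X" "f x = f y" for x y
    using that h sub by (auto simp: f_def bij_betw_def inj_on_def split: if_splits)
  have "pairing {..<Suc n} n (alt_delta (map f ys)) (push X f v)
      = pairing X n (\<lambda>xs. alt_delta (map f ys) (map f xs)) v"
    using f assms(1) by (intro pairing_push) (auto simp: FA_hom_def)
  also have "\<dots> = pairing X n (alt_delta ys) v"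
    unfolding pairing_def using inj
    by (intro sum.cong refl arg_cong[of _ _ "(*) _"] alt_delta_map) (auto simp: lists_on_def)
  finally have "pairing {..<Suc n} n (alt_delta (map f ys)) (push X f v) \<noteq> 0"
    using ys(2) by simp
  then show ?thesis
    using f pairing_sgn_rel[OF alternating_alt_delta] by blast
qed

lemma is_simple_LamPbar: "is_simple fsc (LamPbar n :: (nat list \<Rightarrow> 'k::field_char_0) famod)"
  unfolding is_simple_def
proof (intro conjI allI impI)
  let ?T = "{..<Suc n}" and ?e = "diff_tensor [0..<Suc n] :: nat list \<Rightarrow> 'k"
  show "is_famod fsc (LamPbar n :: (nat list \<Rightarrow> 'k) famod)" by (rule is_famod_LamPbar)
  have e: "?e \<in> Pbar_tens n ?T"
    by (rule diff_tensor_Pbar_tens[OF _ upt_lists_on]) simp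
  then show "\<not> is_zero_mod (LamPbar n :: (nat list \<Rightarrow> 'k) famod)"
    using diff_generator_notin_sgn_rel[of n, where 'k = 'k]
    by (auto simp: is_zero_mod_def LamPbar_def simp del: upt_Suc intro!: exI[of _ ?T])
  fix U :: "nat set \<Rightarrow> (nat list \<Rightarrow> 'k) set"
  assume "is_subfunctor fsc (LamPbar n) U"
  then have sub: "\<And>X. finite X \<Longrightarrow> fsc.subspace (U X)"
    and UM: "\<And>X. finite X \<Longrightarrow> U X \<subseteq> Pbar_tens n X"
    and NU: "\<And>X. finite X \<Longrightarrow> sgn_rel n (Pbar_tens n X) \<subseteq> U X"
    and pushU: "\<And>X Y f v. FA_hom X Y f \<Longrightarrow> v \<in> U X \<Longrightarrow> push X f v \<in> U Y"
    by (auto simp: is_subfunctor_def LamPbar_def)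
  \<comment> \<open>A non-zero value on one set \<open>X\<close> already forces everything on every
    set \<open>Y\<close>.\<close>
  have "U Y = Pbar_tens n Y" if nz: "finite X" "U X \<noteq> sgn_rel n (Pbar_tens n X)" "finite Y" for X Y
  proof
    show "U Y \<subseteq> Pbar_tens n Y" using UM nz by blast
    from nz NU obtain v where v: "v \<in> U X" "v \<notin> sgn_rel n (Pbar_tens n X)" by blast
    then obtain f where f: "FA_hom X ?T f" "push X f v \<notin> sgn_rel n (Pbar_tens n ?T)"
      using exists_push_notin_sgn_rel UM nz by blast
    then have pv: "push X f v \<in> U ?T" using pushU v by blast
    \<comment> \<open>That the value on \<open>n + 1\<close> points is a line is inherited, through
      the contraction, from the top exterior power of the projective.\<close>
    then obtain w where w: "w \<in> Ptens (Suc n) ?T" "pi_map (Suc n) ?T w = push X f v"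
      using pi_map_surj[of ?T] UM[of ?T] by blast
    obtain c where "w - fsc c (generator (Suc n)) \<in> sgn_rel (Suc n) (Ptens (Suc n) ?T)"
      using top_exterior_power_dim_1[OF w(1)] by blast
    then have "pi_map (Suc n) ?T (w - fsc c (generator (Suc n))) \<in> sgn_rel n (Pbar_tens n ?T)"
      by (intro pi_map_sgn_rel) simp
    then have c: "push X f v - fsc c ?e \<in> sgn_rel n (Pbar_tens n ?T)"
      unfolding pi_map_diff pi_map_fsc w(2) pi_map_basis[OF finite_lessThan upt_lists_on] .
    then have "c \<noteq> 0" using f(2) by auto
    have "push X f v - (push X f v - fsc c ?e) \<in> U ?T"
      by (rule fsc.subspace_diff[OF sub pv subsetD[OF NU c]]) simp_all
    then have "fsc c ?e \<in> U ?T" by simp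
    then have "fsc (1 / c) (fsc c ?e) \<in> U ?T"
      by (rule fsc.subspace_scale[OF sub[OF finite_lessThan]])
    then have eU: "?e \<in> U ?T" using \<open>c \<noteq> 0\<close> by simp
    \<comment> \<open>All difference tensors over \<open>Y\<close> are images of \<open>?e\<close>,
      and they span because the contraction is surjective.\<close>
    have D: "diff_tensor xs \<in> U Y" if xs: "xs \<in> lists_on Y (Suc n)" for xs
    proof -
      have "map (list_fun xs) [0..<Suc n] = xs"
        using map_list_fun[of xs] xs by (simp add: lists_on_def)
      then have "push ?T (list_fun xs) ?e = diff_tensor xs"
        by (subst push_diff_tensor[OF finite_lessThan upt_lists_on]) (simp only:)
      then show ?thesis
        using pushU[OF FA_hom_list_fun[OF nz(3) xs] eU] by (simp only:)
    qed
    show "Pbar_tens n Y \<subseteq> U Y"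
    proof
      fix u :: "nat list \<Rightarrow> 'k" assume "u \<in> Pbar_tens n Y"
      then obtain w where "pi_map (Suc n) Y w = u" using pi_map_surj nz(3) by blast
      moreover have "pi_map (Suc n) Y w \<in> U Y"
        unfolding pi_map_Suc using D
        by (intro fsc.subspace_sum[OF sub[OF nz(3)]] fsc.subspace_scale[OF sub[OF nz(3)]])
      ultimately show "u \<in> U Y" by simp
    qed
  qed
  then show "(\<forall>X. finite X \<longrightarrow> U X = Nu (LamPbar n) X) \<or> (\<forall>X. finite X \<longrightarrow> U X = Mo (LamPbar n) X)"
    by (auto simp: LamPbar_def)
qed

text \<open>The only non-zero value is the line spanned by the empty tensor on the empty set; any
  non-zero element rescales to that tensor.\<close>

lemma is_simple_kzero: "is_simple fsc (kzero :: (nat list \<Rightarrow> 'k::field_char_0) famod)"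
  unfolding is_simple_def
proof (intro conjI allI impI)
  let ?e = "tensorl [] :: nat list \<Rightarrow> 'k"
  show "is_famod fsc (kzero :: (nat list \<Rightarrow> 'k) famod)" by (rule is_famod_kzero)
  have "?e [] = 1" by (simp add: tensorl_Nil)
  then have e: "?e \<noteq> 0" by (metis zero_fun_apply zero_neq_one)
  then show "\<not> is_zero_mod (kzero :: (nat list \<Rightarrow> 'k) famod)"
    by (auto simp: is_zero_mod_def kzero_def Ptens_0_eq intro: fsc.span_base)
  fix U :: "nat set \<Rightarrow> (nat list \<Rightarrow> 'k) set"
  assume "is_subfunctor fsc kzero U"
  then have sub: "\<And>X. finite X \<Longrightarrow> fsc.subspace (U X)"
    and UM: "\<And>X. finite X \<Longrightarrow> U X \<subseteq> Mo kzero X"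
    and NU: "\<And>X. finite X \<Longrightarrow> 0 \<in> U X"
    by (auto simp: is_subfunctor_def kzero_def)
  have ne: "U X = {0}" if "finite X" "X \<noteq> {}" for X
    using that UM[of X] NU[of X] by (auto simp: kzero_def)
  have "U {} = Ptens 0 {}" if nz: "U {} \<noteq> {0}"
  proof
    show "U {} \<subseteq> Ptens 0 {}" using UM[of "{}"] by (simp add: kzero_def)
    obtain u where u: "u \<in> U {}" "u \<noteq> 0" using nz NU[of "{}"] by auto
    define a where "a = u []"
    have "u \<in> Ptens 0 {}" using u(1) UM[of "{}"] by (auto simp: kzero_def)
    then have u_eq: "u = fsc a ?e"
      using Ptens_expand[of "{}" u 0] by (simp add: a_def)
    then have "a \<noteq> 0" using u(2) by auto
    have "fsc (1 / a) u \<in> U {}"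
      using fsc.subspace_scale[OF sub[of "{}"] u(1)] by simp
    then have "?e \<in> U {}" using \<open>a \<noteq> 0\<close> by (simp add: u_eq)
    then show "Ptens 0 {} \<subseteq> U {}"
      unfolding Ptens_0_eq using sub[of "{}"] by (intro fsc.span_minimal) auto
  qed
  then show "(\<forall>X. finite X \<longrightarrow> U X = Nu kzero X) \<or> (\<forall>X. finite X \<longrightarrow> U X = Mo kzero X)"
    using ne by (auto simp: kzero_def)
qed

section \<open>Projectivity\<close>

text \<open>Morphisms are linear only on representatives in \<open>Mo\<close>, so membership of
  every partial sum is carried through the induction.\<close>

lemma lin_on_sum:
  assumes "vector_space s" "vector_space s'" "module.subspace s A" "lin_on s s' A h"
    and "finite I" "\<And>i. i \<in> I \<Longrightarrow> f i \<in> A"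
  shows "h (\<Sum>i\<in>I. s (c i) (f i)) = (\<Sum>i\<in>I. s' (c i) (h (f i)))"
proof -
  interpret V: vector_space s by fact
  interpret W: vector_space s' by fact
  \<comment> \<open>\<open>lin_on\<close> does not mention zero; homogeneity for the scalar 0
    supplies the empty sum.\<close>
  have "h (s 0 0) = s' 0 (h 0)"
    using assms(4) V.subspace_0[OF assms(3)] unfolding lin_on_def by blast
  then have h0: "h 0 = 0" by simp
  show ?thesis
    using assms(5,6)
  proof (induction I rule: finite_induct)
    case empty
    then show ?case using h0 by simp
  next
    case (insert i I)
    have f: "f i \<in> A" "s (c i) (f i) \<in> A" "(\<Sum>i\<in>I. s (c i) (f i)) \<in> A"
      using insert.prems by (auto intro!: V.subspace_sum[OF assms(3)] V.subspace_scale[OF assms(3)])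
    have "h (s (c i) (f i) + (\<Sum>i\<in>I. s (c i) (f i))) = s' (c i) (h (f i)) + h (\<Sum>i\<in>I. s (c i) (f i))"
      using assms(4) f unfolding lin_on_def by simp
    then show ?case using insert by simp
  qed
qed

lemma lin_on_diff:
  assumes "vector_space s" "vector_space s'" "module.subspace s A" "lin_on s s' A h" "u \<in> A" "v \<in> A"
  shows "h (u - v) = h u - h v"
proof -
  interpret V: vector_space s by fact
  have "h (u - v + v) = h (u - v) + h v"
    using assms V.subspace_diff[OF assms(3)] unfolding lin_on_def by blast
  then show ?thesis by (simp add: algebra_simps)
qed

lemma antisymmetrize_add: "antisymmetrize n (u + v) = antisymmetrize n u + antisymmetrize n v"
  by (rule ext) (simp add: antisymmetrize_def sum_fun_apply fsc_apply permact_eq algebra_simps sum.distrib)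

lemma antisymmetrize_fsc: "antisymmetrize n (fsc c v) = fsc c (antisymmetrize n v)"
  by (rule ext) (simp add: antisymmetrize_def sum_fun_apply fsc_apply permact_eq sum_distrib_left mult_ac)

lemma antisymmetrize_Ptens:
  assumes "v \<in> Ptens n X"
  shows "antisymmetrize n v \<in> Ptens n X"
  unfolding antisymmetrize_def
  by (intro fsc.subspace_sum[OF subspace_Ptens] fsc.subspace_scale[OF subspace_Ptens])
    (use assms permact_Ptens in auto)

text \<open>The analogue of \<open>pairing_push\<close> with values in an arbitrary vector space; it
  gives naturality of the lift.\<close>

lemma sum_push:
  assumes "vector_space s" "finite X" "finite Y" "f \<in> X \<rightarrow> Y"
  shows "(\<Sum>ys\<in>lists_on Y n. s (push X f v ys) (A ys)) = (\<Sum>xs\<in>lists_on X n. s (v xs) (A (map f xs)))"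
proof -
  interpret vector_space s by fact
  have "(\<Sum>ys\<in>lists_on Y n. s (push X f v ys) (A ys))
      = (\<Sum>ys\<in>lists_on Y n. \<Sum>xs\<in>lists_on X n. if ys = map f xs then s (v xs) (A ys) else 0)"
  proof (intro sum.cong refl)
    fix ys assume "ys \<in> lists_on Y n"
    then have "push X f v ys = (\<Sum>xs\<in>lists_on X n. if ys = map f xs then v xs else 0)"
      unfolding push_def by (simp add: lists_on_def eq_commute[of ys])
    then have "s (push X f v ys) (A ys) = (\<Sum>xs\<in>lists_on X n. s (if ys = map f xs then v xs else 0) (A ys))"
      by (simp add: scale_sum_left)
    also have "\<dots> = (\<Sum>xs\<in>lists_on X n. if ys = map f xs then s (v xs) (A ys) else 0)"
      by (intro sum.cong) auto
    finally show "s (push X f v ys) (A ys)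
        = (\<Sum>xs\<in>lists_on X n. if ys = map f xs then s (v xs) (A ys) else 0)" .
  qed
  also have "\<dots> = (\<Sum>xs\<in>lists_on X n. \<Sum>ys\<in>lists_on Y n. if ys = map f xs then s (v xs) (A ys) else 0)"
    by (rule sum.swap)
  also have "\<dots> = (\<Sum>xs\<in>lists_on X n. s (v xs) (A (map f xs)))"
    using assms map_in_lists_on[OF assms(4)] by (intro sum.cong) (auto simp: sum.delta)
  finally show ?thesis .
qed

text \<open>By the Yoneda lemma a map out of the tensor power is determined by the image of the
  generator; precomposing a lift with the idempotent \<open>antisymmetrize t / t!\<close> makes it vanish on
  the sign relations.\<close>

lemma is_projective_LamP:
  fixes W :: "'w::ab_group_add itself"
  shows "is_projective W fsc (LamP t :: (nat list \<Rightarrow> 'k::field_char_0) famod)"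
  unfolding is_projective_def
proof (intro conjI allI impI)
  show "is_famod fsc (LamP t :: (nat list \<Rightarrow> 'k) famod)" by (rule is_famod_LamP)
  fix s :: "'k \<Rightarrow> 'w \<Rightarrow> 'w" and G H :: "'w famod" and g :: "nat set \<Rightarrow> 'w \<Rightarrow> 'w"
    and h :: "nat set \<Rightarrow> (nat list \<Rightarrow> 'k) \<Rightarrow> 'w"
  assume G: "is_famod s G" and H: "is_famod s H" and g: "is_mor s s G H g" and epi: "is_epi G H g"
    and h: "is_mor fsc s (LamP t) H h"
  let ?T = "{..<t}" and ?e = "generator t :: nat list \<Rightarrow> 'k"
  interpret vector_space s using G by (simp add: is_famod_def)
  note vs = vector_space_axioms
  have subG: "subspace (Mo G X)" "subspace (Nu G X)" if "finite X" for X
    using G that by (auto simp: is_famod_def)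
  have subH: "subspace (Mo H X)" "subspace (Nu H X)" if "finite X" for X
    using H that by (auto simp: is_famod_def)
  have actG: "act G X Y f v \<in> Mo G Y" if "FA_hom X Y f" "v \<in> Mo G X" for X Y f v
    using G that by (simp add: is_famod_def)
  have actH: "act H X Y f v \<in> Nu H Y" if "FA_hom X Y f" "v \<in> Nu H X" for X Y f v
    using H that by (simp add: is_famod_def)
  have linG: "lin_on s s (Mo G X) (act G X Y f)" if "FA_hom X Y f" for X Y f
    using G that by (simp add: is_famod_def)
  have linH: "lin_on s s (Mo H X) (act H X Y f)" if "FA_hom X Y f" for X Y f
    using H that by (simp add: is_famod_def)
  have compG: "act G X Z (compose X k f) v - act G Y Z k (act G X Y f v) \<in> Nu G Z"
    if "FA_hom X Y f" "FA_hom Y Z k" "v \<in> Mo G X" for X Y Z f k v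
    using G that by (simp add: is_famod_def)
  have gM: "g X v \<in> Mo H X" if "finite X" "v \<in> Mo G X" for X v
    using g that by (simp add: is_mor_def)
  have ling: "lin_on s s (Mo G X) (g X)" if "finite X" for X
    using g that by (simp add: is_mor_def)
  have natg: "g Y (act G X Y f v) - act H X Y f (g X v) \<in> Nu H Y"
    if "FA_hom X Y f" "v \<in> Mo G X" for X Y f v
    using g that by (simp add: is_mor_def)
  have hM: "h X v \<in> Mo H X" if "finite X" "v \<in> Ptens t X" for X v
    using h that by (simp add: is_mor_def LamP_def)
  have hN: "h X v \<in> Nu H X" if "finite X" "v \<in> sgn_rel t (Ptens t X)" for X v
    using h that by (simp add: is_mor_def LamP_def)
  have linh: "lin_on fsc s (Ptens t X) (h X)" if "finite X" for X
    using h that by (simp add: is_mor_def LamP_def)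
  have nath: "h Y (push X f v) - act H X Y f (h X v) \<in> Nu H Y"
    if "FA_hom X Y f" "v \<in> Ptens t X" for X Y f v
    using h that by (simp add: is_mor_def LamP_def)

  have he: "h ?T ?e \<in> Mo H ?T" by (rule hM[OF _ generator_Ptens]) simp
  \<comment> \<open>The Yoneda datum of the lift: a preimage, modulo relations of \<open>H\<close>,
    of the image of the generator.\<close>
  then obtain y where y: "y \<in> Mo G ?T" "g ?T y - h ?T ?e \<in> Nu H ?T"
    using epi unfolding is_epi_def by blast
  define A where "A X xs = act G ?T X (list_fun xs) y" for X xs
  define p where "p v = fsc (1 / fact t) (antisymmetrize t v)" for v :: "nat list \<Rightarrow> 'k"
  \<comment> \<open>Expanding \<open>p v\<close> instead of \<open>v\<close> sends sign relations to
    0 on the nose.\<close>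
  define l where "l X v = (\<Sum>xs\<in>lists_on X t. s (p v xs) (A X xs))" for X v
  have pP: "p v \<in> Ptens t X" if "v \<in> Ptens t X" for v X
    unfolding p_def by (intro fsc.subspace_scale[OF subspace_Ptens] antisymmetrize_Ptens that)
  have AG: "A X xs \<in> Mo G X" if "finite X" "xs \<in> lists_on X t" for X xs
    unfolding A_def by (rule actG[OF FA_hom_list_fun[OF that] y(1)])

  have lM: "l X v \<in> Mo G X" if "finite X" for X v
    unfolding l_def using that AG by (intro subspace_sum[OF subG(1)] subspace_scale[OF subG(1)])
  have lN: "l X v \<in> Nu G X" if X: "finite X" and N: "v \<in> sgn_rel t (Ptens t X)" for X v
  proof -
    have v: "v \<in> Ptens t X" using X N P.sgn_rel_V by blast
    have "p v xs = 0" if xs: "xs \<in> lists_on X t" for xs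
      using antisymmetrize_eq_pairing[OF X v, of xs] xs
        pairing_sgn_rel[OF alternating_alt_delta N]
      by (simp add: p_def fsc_apply lists_on_def)
    then show ?thesis using subspace_0[OF subG(2)[OF X]] by (simp add: l_def)
  qed
  have linl: "lin_on fsc s (Ptens t X) (l X)" for X
    unfolding lin_on_def l_def p_def
    by (simp add: antisymmetrize_add antisymmetrize_fsc fsc_apply distrib_left scale_left_distrib
        sum.distrib scale_sum_right mult_ac)
  have natl: "l Y (push X f v) - act G X Y f (l X v) \<in> Nu G Y"
    if f: "FA_hom X Y f" and v: "v \<in> Ptens t X" for X Y f v
  proof -
    have fin: "finite X" "finite Y" and f': "f \<in> X \<rightarrow> Y"
      using f by (auto simp: FA_hom_def)
    \<comment> \<open>Once the projection commutes with \<open>push\<close>, naturality is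
      functoriality of \<open>G\<close> on each basis list, which holds modulo
      \<open>Nu G\<close>.\<close>
    have "p (push X f v) = push X f (p v)"
      using v by (simp add: p_def push_antisymmetrize push_fsc)
    then have "l Y (push X f v) = (\<Sum>xs\<in>lists_on X t. s (p v xs) (A Y (map f xs)))"
      unfolding l_def by (simp add: sum_push[OF vs fin f'])
    moreover have "act G X Y f (l X v) = (\<Sum>xs\<in>lists_on X t. s (p v xs) (act G X Y f (A X xs)))"
      unfolding l_def by (rule lin_on_sum[OF vs vs subG(1) linG]) (use fin f AG in auto)
    moreover have "A Y (map f xs) - act G X Y f (A X xs) \<in> Nu G Y" if "xs \<in> lists_on X t" for xs
      using compG[OF FA_hom_list_fun[OF fin(1) that] f y(1)] compose_list_fun[of xs f] that
      by (simp add: A_def lists_on_def)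
    then have "(\<Sum>xs\<in>lists_on X t. s (p v xs) (A Y (map f xs) - act G X Y f (A X xs))) \<in> Nu G Y"
      by (intro subspace_sum[OF subG(2)] subspace_scale[OF subG(2)] fin)
    ultimately show ?thesis by (simp add: scale_right_diff_distrib sum_subtractf)
  qed
  have gl: "g X (l X v) - h X v \<in> Nu H X" if X: "finite X" and v: "v \<in> Ptens t X" for X v
  proof -
    \<comment> \<open>Three congruences combine: naturality of \<open>g\<close>, the choice of
      \<open>y\<close>, and naturality of \<open>h\<close>.\<close>
    have basis: "g X (A X xs) - h X (tensorl (map ev xs)) \<in> Nu H X" if xs: "xs \<in> lists_on X t" for xs
    proof -
      note f = FA_hom_list_fun[OF X xs]
      have a: "g X (A X xs) - act H ?T X (list_fun xs) (g ?T y) \<in> Nu H X"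
        unfolding A_def by (rule natg[OF f y(1)])
      have "act H ?T X (list_fun xs) (g ?T y - h ?T ?e) \<in> Nu H X"
        by (rule actH[OF f y(2)])
      then have b: "act H ?T X (list_fun xs) (g ?T y) - act H ?T X (list_fun xs) (h ?T ?e) \<in> Nu H X"
        using lin_on_diff[OF vs vs subH(1) linH[OF f] gM he] y(1) by simp
      have c: "h X (tensorl (map ev xs)) - act H ?T X (list_fun xs) (h ?T ?e) \<in> Nu H X"
        using nath[OF f generator_Ptens] push_generator[OF xs, where 'k = 'k] by simp
      from subspace_diff[OF subH(2)[OF X] subspace_add[OF subH(2)[OF X] a b] c]
      show ?thesis by simp
    qed
    have "g X (l X v) = (\<Sum>xs\<in>lists_on X t. s (p v xs) (g X (A X xs)))"
      unfolding l_def by (rule lin_on_sum[OF vs vs subG(1) ling]) (use X AG in auto)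
    moreover have "h X (p v) = (\<Sum>xs\<in>lists_on X t. s (p v xs) (h X (tensorl (map ev xs))))"
      by (subst Ptens_expand[OF X pP[OF v]], rule lin_on_sum[OF vector_space_fsc vs subspace_Ptens linh])
        (use X basis_Ptens in auto)
    moreover have "(\<Sum>xs\<in>lists_on X t. s (p v xs) (g X (A X xs) - h X (tensorl (map ev xs)))) \<in> Nu H X"
      using basis by (intro subspace_sum[OF subH(2)] subspace_scale[OF subH(2)] X)
    ultimately have 1: "g X (l X v) - h X (p v) \<in> Nu H X"
      by (simp add: scale_right_diff_distrib sum_subtractf)
    \<comment> \<open>The projection entered through the lift only; it is removed from
      \<open>h\<close> because \<open>v\<close> and \<open>p v\<close> differ by a sign
      relation.\<close>
    have "h X (v - p v) \<in> Nu H X"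
      unfolding p_def by (rule hN[OF X diff_antisymmetrize_in_sgn_rel[OF v]])
    then have 2: "h X v - h X (p v) \<in> Nu H X"
      using lin_on_diff[OF vector_space_fsc vs subspace_Ptens linh[OF X] v pP[OF v]] by simp
    from subspace_diff[OF subH(2)[OF X] 1 2] show ?thesis by simp
  qed
  show "\<exists>l. is_mor fsc s (LamP t) G l \<and>
      (\<forall>X. finite X \<longrightarrow> (\<forall>v\<in>Mo (LamP t) X. g X (l X v) - h X v \<in> Nu H X))"
    using lM lN linl natl gl
    by (intro exI[of _ l] conjI) (simp_all add: is_mor_def LamP_def)
qed

theorem mainTheorem10:
  fixes t :: nat and W :: "'w::ab_group_add itself"
  shows "is_ses fsc fsc fsc (LamPbar t) (LamP t :: (nat list \<Rightarrow> 'k::field_char_0) famod)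
            (LamPbar_pred t) iota_map (pi_map t)
       \<and> is_simple fsc (LamPbar_pred t :: (nat list \<Rightarrow> 'k) famod)
       \<and> is_projective_cover W fsc fsc (LamP t :: (nat list \<Rightarrow> 'k) famod) (LamPbar_pred t) (pi_map t)
       \<and> is_projective W fsc (LamP t :: (nat list \<Rightarrow> 'k) famod)
       \<and> is_indecomposable fsc (LamP t :: (nat list \<Rightarrow> 'k) famod)"
proof (intro conjI)
  show "is_simple fsc (LamPbar_pred t :: (nat list \<Rightarrow> 'k) famod)"
    by (simp add: LamPbar_pred_def is_simple_LamPbar is_simple_kzero)
  show "is_projective_cover W fsc fsc (LamP t :: (nat list \<Rightarrow> 'k) famod) (LamPbar_pred t) (pi_map t)"
    unfolding is_projective_cover_def
  proof (intro conjI is_projective_LamP is_famod_LamPbar_pred is_mor_pi is_epi_pi)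
    show "\<forall>U. is_subfunctor fsc (LamP t :: (nat list \<Rightarrow> 'k) famod) U \<longrightarrow>
        (\<forall>X. finite X \<longrightarrow> (\<forall>v\<in>Mo (LamP t) X. \<exists>u\<in>U X. \<exists>k\<in>Mo (LamP t) X.
          pi_map t X k \<in> Nu (LamPbar_pred t) X \<and> v = u + k)) \<longrightarrow>
        (\<forall>X. finite X \<longrightarrow> U X = Mo (LamP t) X)"
      by (intro allI impI) (rule ker_pi_superfluous)
  qed
qed (rule is_ses_LamP is_projective_LamP is_indecomposable_LamP)+

end
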